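(* Let $\mathbb{F}$ be a field, $G$ a finite simple graph and $R\subseteq V(G)$. There is an $\mathcal{H}(G,R)$-module decomposition \[ \mathcal{H}(G,R)=\bigoplus_{I\in\mathcal{I}(G-R)}\mathbf{P}_I(G,R) \] where each $\mathbf{P}_I(G,R):=\mathcal{H}(G,R)X_IX^-_{G-R-I}$ is an indecomposable $\mathcal{H}(G,R)$-module with a basis \[ \left\{X_{I+J}X^-_{G-R-I}: J\in\mathcal{I}(R-N(I))\right\} \] and hence has dimension $|\mathcal{I}(R-N(I))|$. The top of $\mathbf{P}_I(G,R)$, denoted by $\mathbf{C}_I(G,R)$, is one-dimensional, and $\mathcal{H}(G,R)$ acts on it by $x_v=1$ if $v\in I$ and $x_v=0$ if $v\in V(G)\setminus I$.
   Context: For a finite simple graph $G$ with vertex set $V(G)$ and edge set $E(G)$, and $R\subseteq V(G)$, $\mathcal{H}(G,R)$ is the quotient of the polynomial algebra $\mathbb{F}[x_v:v\in V(G)]$ by the ideal generated by $\{x_r^2:r\in R\}\cup\{x_v^2-x_v:v\in V(G)\setminus R\}\cup\{x_ux_v:uv\in E(G)\}$. The image of $x_v$ is still denoted $x_v$, and $x_v^-:=1-x_v$. For $U\subseteq V(G)$, $X_U:=\prod_{u\in U}x_u$ and $X_U^-:=\prod_{u\in U}x_u^-$; $N(U)$ is the set of all vertices adjacent in $G$ to some $u\in U$. The symbols $+$ and $-$ denote union and difference of sets, and a subset $U\subseteq V(G)$ is identified with the subgraph of $G$ it induces; thus $G-R$ is the subgraph induced by $V(G)\setminus R$, and $G-R-I$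 stands for $V(G)\setminus(R\cup I)$. $\mathcal{I}(\cdot)$ denotes the set of all independent sets (sets of pairwise non-adjacent vertices, including $\emptyset$) of a graph. The top of a module $M$ is $M/\operatorname{rad}(M)$, where $\operatorname{rad}(M)$ is the intersection of all maximal submodules of $M$. *)

theory Defs
  imports
    "HOL-Library.Poly_Mapping"
    "HOL-Algebra.Algebra"
    "HOL-Algebra.Algebraic_Closure_Type"
    "Graph_Theory.Graph_Theory"
begin

section \<open>Modules\<close>

text \<open>
  A module is a record of type \<open>('a, 'b) module\<close>, which extends the ring record. The fields
  \<open>mult\<close> and \<open>one\<close> of a module play no role in the locale \<open>module\<close>, and none below.
\<close>

definition regular_module :: "('a, 'm) ring_scheme \<Rightarrow> ('a, 'a) module" where
  "regular_module A =
     \<lparr>carrier = carrier A, monoid.mult = monoid.mult A, one = \<one>\<^bsub>A\<^esub>,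
      ring.zero = \<zero>\<^bsub>A\<^esub>, ring.add = ring.add A, module.smult = monoid.mult A\<rparr>"

definition quotient_module :: "('a, 'b) module \<Rightarrow> 'b set \<Rightarrow> ('a, 'b set) module" where
  "quotient_module M N =
     \<lparr>carrier = a_rcosets\<^bsub>M\<^esub> N, monoid.mult = rcoset_mult M N, one = N +>\<^bsub>M\<^esub> \<one>\<^bsub>M\<^esub>,
      ring.zero = N, ring.add = set_add M,
      module.smult = (\<lambda>a S. \<Union>x\<in>S. N +>\<^bsub>M\<^esub> (a \<odot>\<^bsub>M\<^esub> x))\<rparr>"

definition restrict_scalars :: "('k \<Rightarrow> 'a) \<Rightarrow> ('a, 'b) module \<Rightarrow> ('k, 'b) module" where
  "restrict_scalars \<phi> M =
     \<lparr>carrier = carrier M, monoid.mult = monoid.mult M, one = \<one>\<^bsub>M\<^esub>,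
      ring.zero = \<zero>\<^bsub>M\<^esub>, ring.add = ring.add M, module.smult = (\<lambda>k m. \<phi> k \<odot>\<^bsub>M\<^esub> m)\<rparr>"

text \<open>Internal direct sum of a finite family of submodules.\<close>

definition is_direct_sum ::
    "('a, 'm) ring_scheme \<Rightarrow> ('a, 'b) module \<Rightarrow> 'i set \<Rightarrow> ('i \<Rightarrow> 'b set) \<Rightarrow> bool" where
  "is_direct_sum A M S N \<longleftrightarrow>
     module A M \<and> finite S \<and> (\<forall>i\<in>S. submodule (N i) A M) \<and>
     (\<forall>m\<in>carrier M. \<exists>!f. f \<in> (\<Pi>\<^sub>E i\<in>S. N i) \<and> m = (\<Oplus>\<^bsub>M\<^esub>i\<in>S. f i))"

definition indecomposable :: "('a, 'm) ring_scheme \<Rightarrow> ('a, 'b) module \<Rightarrow> bool" where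
  "indecomposable A M \<longleftrightarrow>
     module A M \<and> carrier M \<noteq> {\<zero>\<^bsub>M\<^esub>} \<and>
     \<not> (\<exists>N L. submodule N A M \<and> submodule L A M \<and> N \<noteq> {\<zero>\<^bsub>M\<^esub>} \<and> L \<noteq> {\<zero>\<^bsub>M\<^esub>} \<and>
             N \<inter> L = {\<zero>\<^bsub>M\<^esub>} \<and> N <+>\<^bsub>M\<^esub> L = carrier M)"

definition maximal_submodule :: "'b set \<Rightarrow> ('a, 'm) ring_scheme \<Rightarrow> ('a, 'b) module \<Rightarrow> bool" where
  "maximal_submodule N A M \<longleftrightarrow>
     submodule N A M \<and> N \<noteq> carrier M \<and>
     (\<forall>L. submodule L A M \<and> N \<subseteq> L \<longrightarrow> L = N \<or> L = carrier M)"

text \<open>The intersection with the carrier only matters if there is no maximal submodule.\<close>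

definition rad :: "('a, 'm) ring_scheme \<Rightarrow> ('a, 'b) module \<Rightarrow> 'b set" where
  "rad A M = carrier M \<inter> \<Inter>{N. maximal_submodule N A M}"

definition top_module :: "('a, 'm) ring_scheme \<Rightarrow> ('a, 'b) module \<Rightarrow> ('a, 'b set) module" where
  "top_module A M = quotient_module M (rad A M)"

definition lin_indep :: "('k, 'm) ring_scheme \<Rightarrow> ('k, 'b) module \<Rightarrow> 'b set \<Rightarrow> bool" where
  "lin_indep K M B \<longleftrightarrow>
     (\<forall>S c. finite S \<and> S \<subseteq> B \<and> c \<in> S \<rightarrow> carrier K \<and> (\<Oplus>\<^bsub>M\<^esub>b\<in>S. c b \<odot>\<^bsub>M\<^esub> b) = \<zero>\<^bsub>M\<^esub>
        \<longrightarrow> (\<forall>b\<in>S. c b = \<zero>\<^bsub>K\<^esub>))"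

definition spanning :: "('k, 'm) ring_scheme \<Rightarrow> ('k, 'b) module \<Rightarrow> 'b set \<Rightarrow> bool" where
  "spanning K M B \<longleftrightarrow>
     (\<forall>m\<in>carrier M. \<exists>S c. finite S \<and> S \<subseteq> B \<and> c \<in> S \<rightarrow> carrier K \<and> m = (\<Oplus>\<^bsub>M\<^esub>b\<in>S. c b \<odot>\<^bsub>M\<^esub> b))"

definition is_basis :: "('k, 'm) ring_scheme \<Rightarrow> ('k, 'b) module \<Rightarrow> 'b set \<Rightarrow> bool" where
  "is_basis K M B \<longleftrightarrow> module K M \<and> B \<subseteq> carrier M \<and> lin_indep K M B \<and> spanning K M B"

definition has_dimension :: "('k, 'm) ring_scheme \<Rightarrow> ('k, 'b) module \<Rightarrow> nat \<Rightarrow> bool" where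
  "has_dimension K M n \<longleftrightarrow> (\<exists>B. is_basis K M B \<and> finite B \<and> card B = n)"


section \<open>Graphs\<close>

text \<open>
  Finite simple graphs are given by the locale \<open>graph\<close>: finite, loop-free, symmetric digraphs
  without parallel arcs, so that an edge \<open>uv\<close> is a pair of opposite arcs.
\<close>

definition independent_sets :: "('v, 'e) pre_digraph \<Rightarrow> 'v set set" where
  "independent_sets G = {S. S \<subseteq> verts G \<and> pairwise (\<lambda>u v. \<not> dominates G u v) S}"

definition neighbours :: "('v, 'e) pre_digraph \<Rightarrow> 'v set \<Rightarrow> 'v set" where
  "neighbours G U = {v. \<exists>u\<in>U. dominates G u v}"


section \<open>The algebra \<open>\<H>(G,R)\<close>\<close>

text \<open>
  A monomial is a finitely supported exponent function, and a polynomial is a finitely supported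
  coefficient function on monomials.
\<close>

type_synonym ('v, 'a) poly_in = "('v \<Rightarrow>\<^sub>0 nat) \<Rightarrow>\<^sub>0 'a"

definition pvar :: "'v \<Rightarrow> ('v, 'a::field) poly_in" where
  "pvar v = Poly_Mapping.single (Poly_Mapping.single v 1) 1"

definition pconst :: "'a::field \<Rightarrow> ('v, 'a) poly_in" where
  "pconst c = Poly_Mapping.single 0 c"

definition polynomial_algebra :: "'v set \<Rightarrow> ('v, 'a::field) poly_in ring" where
  "polynomial_algebra V =
     ring_of_type_algebra\<lparr>carrier := {p. \<forall>m\<in>Poly_Mapping.keys p. Poly_Mapping.keys m \<subseteq> V}\<rparr>"

definition H_ideal :: "('v, 'e) pre_digraph \<Rightarrow> 'v set \<Rightarrow> ('v, 'a::field) poly_in set" where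
  "H_ideal G R = Idl\<^bsub>polynomial_algebra (verts G)\<^esub>
     ({pvar r ^ 2 | r. r \<in> R} \<union>
      {pvar v ^ 2 - pvar v | v. v \<in> verts G - R} \<union>
      {pvar u * pvar v | u v. dominates G u v})"

definition H_alg :: "('v, 'e) pre_digraph \<Rightarrow> 'v set \<Rightarrow> ('v, 'a::field) poly_in set ring" where
  "H_alg G R = polynomial_algebra (verts G) Quot H_ideal G R"

definition H_class ::
    "('v, 'e) pre_digraph \<Rightarrow> 'v set \<Rightarrow> ('v, 'a::field) poly_in \<Rightarrow> ('v, 'a) poly_in set" where
  "H_class G R p = H_ideal G R +>\<^bsub>polynomial_algebra (verts G)\<^esub> p"

text \<open>
  \<open>H_x\<close>, \<open>H_x_minus\<close>, \<open>H_X\<close>, \<open>H_X_minus\<close> are \<open>x_v\<close>, \<open>x_v^- = 1 - x_v\<close>, \<open>X_U\<close>, \<open>X_U^-\<close>, taken in the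
  quotient algebra.
\<close>

definition H_x :: "('v, 'e) pre_digraph \<Rightarrow> 'v set \<Rightarrow> 'v \<Rightarrow> ('v, 'a::field) poly_in set" where
  "H_x G R v = H_class G R (pvar v)"

definition H_x_minus :: "('v, 'e) pre_digraph \<Rightarrow> 'v set \<Rightarrow> 'v \<Rightarrow> ('v, 'a::field) poly_in set" where
  "H_x_minus G R v = \<one>\<^bsub>H_alg G R\<^esub> \<ominus>\<^bsub>H_alg G R\<^esub> H_x G R v"

definition H_X :: "('v, 'e) pre_digraph \<Rightarrow> 'v set \<Rightarrow> 'v set \<Rightarrow> ('v, 'a::field) poly_in set" where
  "H_X G R U = (\<Otimes>\<^bsub>H_alg G R\<^esub>u\<in>U. H_x G R u)"

definition H_X_minus :: "('v, 'e) pre_digraph \<Rightarrow> 'v set \<Rightarrow> 'v set \<Rightarrow> ('v, 'a::field) poly_in set" where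
  "H_X_minus G R U = (\<Otimes>\<^bsub>H_alg G R\<^esub>u\<in>U. H_x_minus G R u)"

definition H_module ::
    "('v, 'e) pre_digraph \<Rightarrow> 'v set
      \<Rightarrow> (('v, 'a::field) poly_in set, ('v, 'a) poly_in set) module" where
  "H_module G R = regular_module (H_alg G R)"

definition P_set ::
    "('v, 'e) pre_digraph \<Rightarrow> 'v set \<Rightarrow> 'v set \<Rightarrow> ('v, 'a::field) poly_in set set" where
  "P_set G R I = PIdl\<^bsub>H_alg G R\<^esub> (H_X G R I \<otimes>\<^bsub>H_alg G R\<^esub> H_X_minus G R (verts G - R - I))"

definition P_module ::
    "('v, 'e) pre_digraph \<Rightarrow> 'v set \<Rightarrow> 'v set
      \<Rightarrow> (('v, 'a::field) poly_in set, ('v, 'a) poly_in set) module" where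
  "P_module G R I = (H_module G R)\<lparr>carrier := P_set G R I\<rparr>"

definition C_module ::
    "('v, 'e) pre_digraph \<Rightarrow> 'v set \<Rightarrow> 'v set
      \<Rightarrow> (('v, 'a::field) poly_in set, ('v, 'a) poly_in set set) module" where
  "C_module G R I = top_module (H_alg G R) (P_module G R I)"

text \<open>The vector space underlying an \<open>\<H>(G,R)\<close>-module, via the structure map of the algebra.\<close>

definition as_vector_space ::
    "('v, 'e) pre_digraph \<Rightarrow> 'v set \<Rightarrow> (('v, 'a::field) poly_in set, 'b) module \<Rightarrow> ('a, 'b) module" where
  "as_vector_space G R M = restrict_scalars (\<lambda>c. H_class G R (pconst c)) M"

end

theory Submission
  imports Defs
begin

text \<open>
  For independent sets \<open>I\<close> of \<open>G - R\<close> and \<open>J\<close> of \<open>R - N(I)\<close>, setting \<open>x\<^sub>v = 1\<close> on \<open>I\<close> and \<open>x\<^sub>v = 0\<close>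
  outside \<open>I \<union> J\<close> and then taking the coefficient of the squarefree monomial \<open>X\<^sub>J\<close> gives a linear
  form on polynomials, the jet at \<open>(I, J)\<close>. The jet of \<open>x\<^sub>v p\<close> is a jet of \<open>p\<close> or zero, so that the
  jets vanish on the defining ideal. Conversely, \<open>e\<^sub>I = X\<^sub>I X\<^sup>-\<^sub>G\<^sub>-\<^sub>R\<^sub>-\<^sub>I\<close> satisfies
  \<open>p e\<^sub>I = \<Sum>\<^sub>J jet\<^sub>I\<^sub>J(p) X\<^sub>J e\<^sub>I\<close> in the quotient, and the \<open>e\<^sub>I\<close> add up to \<open>1\<close>. Hence the jets are the
  coordinates of the quotient algebra in the basis \<open>X\<^sub>J e\<^sub>I\<close>, which yields the decomposition and the
  bases. An element of \<open>P\<^sub>I\<close> with nonzero jet at \<open>(I, \<emptyset>)\<close> generates \<open>P\<^sub>I\<close>. So the kernel of this jet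
  is the greatest proper submodule, which makes \<open>P\<^sub>I\<close> indecomposable and its top one-dimensional.
\<close>

section \<open>Modules\<close>

lemma ring_of_type_algebra_simps [simp]:
  "carrier (ring_of_type_algebra :: 'a::ring_1 ring) = UNIV"
  "monoid.mult (ring_of_type_algebra :: 'a ring) = (*)"
  "one (ring_of_type_algebra :: 'a ring) = 1"
  "ring.zero (ring_of_type_algebra :: 'a ring) = 0"
  "ring.add (ring_of_type_algebra :: 'a ring) = (+)"
  by (auto simp: ring_of_type_algebra_def)

lemma regular_module_simps [simp]:
  "carrier (regular_module A) = carrier A"
  "ring.zero (regular_module A) = \<zero>\<^bsub>A\<^esub>"
  "ring.add (regular_module A) = ring.add A"
  "module.smult (regular_module A) = monoid.mult A"
  by (auto simp: regular_module_def)

lemma restrict_scalars_simps [simp]: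
  "carrier (restrict_scalars \<phi> M) = carrier M"
  "ring.zero (restrict_scalars \<phi> M) = \<zero>\<^bsub>M\<^esub>"
  "ring.add (restrict_scalars \<phi> M) = ring.add M"
  "module.smult (restrict_scalars \<phi> M) k m = \<phi> k \<odot>\<^bsub>M\<^esub> m"
  by (auto simp: restrict_scalars_def)

lemma quotient_module_simps [simp]:
  "carrier (quotient_module M N) = a_rcosets\<^bsub>M\<^esub> N"
  "ring.zero (quotient_module M N) = N"
  "ring.add (quotient_module M N) = set_add M"
  by (auto simp: quotient_module_def)

text \<open>The group axioms involve only carrier, zero and addition. The module constructions yield
  records of other types with these same fields, so the axioms carry over.\<close>

lemma abelian_group_cong:
  assumes "abelian_group M" "carrier M' = carrier M" "ring.zero M' = \<zero>\<^bsub>M\<^esub>" "ring.add M' = ring.add M"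
  shows "abelian_group M'"
proof -
  interpret abelian_group M by fact
  show ?thesis
    by (rule abelian_groupI) (auto simp: assms a_ac intro!: bexI[OF _ a_inv_closed] l_neg)
qed

lemma module_regular_module:
  assumes "cring A"
  shows "module A (regular_module A)"
proof -
  interpret cring A by fact
  show ?thesis
    by (rule moduleI)
      (auto simp: assms l_distr r_distr m_assoc intro: abelian_group_cong[OF is_abelian_group])
qed

lemma submodule_regular_moduleI:
  assumes "cring A" "ideal I A"
  shows "submodule I A (regular_module A)"
proof -
  interpret cring A by fact
  interpret I: ideal I A by fact
  interpret M: module A "regular_module A"
    by (rule module_regular_module) fact
  \<comment> \<open>\<open>a_inv\<close> is the inverse in the additive monoid record, which is the
    same for \<open>A\<close> and its regular module.\<close>
  have "\<ominus>\<^bsub>regular_module A\<^esub> x = \<ominus>\<^bsub>A\<^esub> x" for x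
    by (simp add: a_inv_def m_inv_def)
  then show ?thesis
    by (intro M.submoduleI) (auto simp: I.a_Hcarr I.I_l_closed)
qed

lemma module_restrict_scalars:
  assumes "ring_hom_cring K A \<phi>" "module A M"
  shows "module K (restrict_scalars \<phi> M)"
proof -
  interpret ring_hom_cring K A \<phi> by fact
  interpret M: module A M by fact
  show ?thesis
    by (rule moduleI)
      (auto simp: R.is_cring M.smult_l_distr M.smult_r_distr M.smult_assoc1
        intro: abelian_group_cong[OF M.abelian_group_axioms])
qed

section \<open>Quotient modules\<close>

context
  fixes A :: "('a, 'm) ring_scheme" and M :: "('a, 'b) module" and N
  assumes M: "module A M" and N: "submodule N A M"
begin

interpretation module A M by (rule M)

interpretation N: submodule N A M by (rule N)

interpretation abelian_subgroup N M
  by (intro abelian_subgroupI3 additive_subgroupI N.subgroup_axioms M.abelian_group_axioms)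

lemma quotient_module_carrier: "carrier (quotient_module M N) = (\<lambda>x. N +>\<^bsub>M\<^esub> x) ` carrier M"
  by (auto simp: A_RCOSETS_def' a_r_coset_def')

lemma coset_eq_iff:
  assumes "x \<in> carrier M" "y \<in> carrier M"
  shows "N +>\<^bsub>M\<^esub> x = N +>\<^bsub>M\<^esub> y \<longleftrightarrow> x \<ominus>\<^bsub>M\<^esub> y \<in> N"
proof -
  have "N +>\<^bsub>M\<^esub> x = N +>\<^bsub>M\<^esub> y \<longleftrightarrow> x \<in> N +>\<^bsub>M\<^esub> y"
    using assms a_repr_independence' a_repr_independenceD by (metis (no_types))
  then show ?thesis
    using a_rcos_module[of y x] assms by (simp add: a_minus_def)
qed

lemma quotient_module_add:
  assumes "x \<in> carrier M" "y \<in> carrier M"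
  shows "(N +>\<^bsub>M\<^esub> x) \<oplus>\<^bsub>quotient_module M N\<^esub> (N +>\<^bsub>M\<^esub> y) = N +>\<^bsub>M\<^esub> (x \<oplus>\<^bsub>M\<^esub> y)"
  using a_rcos_sum[OF assms] by simp

text \<open>The scalar action is defined as a union over all representatives of a coset. Two
  representatives differ by an element of \<open>N\<close>, and so do their multiples by
  \<open>a\<close>; hence all members of the union coincide.\<close>

lemma quotient_module_smult:
  assumes "a \<in> carrier A" "x \<in> carrier M"
  shows "a \<odot>\<^bsub>quotient_module M N\<^esub> (N +>\<^bsub>M\<^esub> x) = N +>\<^bsub>M\<^esub> (a \<odot>\<^bsub>M\<^esub> x)"
proof -
  have "N +>\<^bsub>M\<^esub> (a \<odot>\<^bsub>M\<^esub> y) = N +>\<^bsub>M\<^esub> (a \<odot>\<^bsub>M\<^esub> x)" if "y \<in> N +>\<^bsub>M\<^esub> x" for y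
  proof -
    have y: "y \<in> carrier M" "y \<ominus>\<^bsub>M\<^esub> x \<in> N"
      using a_elemrcos_carrier[OF assms(2) that] a_rcos_module_imp[OF assms(2) that]
      by (simp_all add: a_minus_def)
    have "a \<odot>\<^bsub>M\<^esub> y \<ominus>\<^bsub>M\<^esub> a \<odot>\<^bsub>M\<^esub> x = a \<odot>\<^bsub>M\<^esub> (y \<ominus>\<^bsub>M\<^esub> x)"
      using assms y by (simp add: a_minus_def smult_r_distr smult_r_minus)
    then show ?thesis
      using assms y by (simp add: coset_eq_iff)
  qed
  moreover have "x \<in> N +>\<^bsub>M\<^esub> x"
    using assms by (simp add: a_rcos_self)
  ultimately have "(\<Union>y\<in>N +>\<^bsub>M\<^esub> x. N +>\<^bsub>M\<^esub> (a \<odot>\<^bsub>M\<^esub> y)) = N +>\<^bsub>M\<^esub> (a \<odot>\<^bsub>M\<^esub> x)"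
    by blast
  then show ?thesis
    by (simp add: quotient_module_def)
qed

lemma module_quotient_module: "module A (quotient_module M N)"
proof (rule moduleI)
  let ?Q = "quotient_module M N"
  \<comment> \<open>The zero of the quotient is \<open>N\<close> itself; written as a coset it obeys
    the same rules as the other elements.\<close>
  have zero: "\<zero>\<^bsub>?Q\<^esub> = N +>\<^bsub>M\<^esub> \<zero>\<^bsub>M\<^esub>"
    by (simp add: a_rcos_const)
  have elim: "\<exists>x\<in>carrier M. S = N +>\<^bsub>M\<^esub> x" if "S \<in> carrier ?Q" for S
    using that unfolding quotient_module_carrier by blast
  have coset: "N +>\<^bsub>M\<^esub> x \<in> carrier ?Q" if "x \<in> carrier M" for x
    using that unfolding quotient_module_carrier by blast
  note simps = quotient_module_add quotient_module_smult coset M.a_closed smult_closed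
  show "abelian_group ?Q"
  proof (rule abelian_groupI)
    show "\<zero>\<^bsub>?Q\<^esub> \<in> carrier ?Q"
      unfolding zero by (rule coset) simp
  next
    fix S T U
    assume "S \<in> carrier ?Q" "T \<in> carrier ?Q" "U \<in> carrier ?Q"
    then obtain x y z where "x \<in> carrier M" "S = N +>\<^bsub>M\<^esub> x" "y \<in> carrier M" "T = N +>\<^bsub>M\<^esub> y"
      "z \<in> carrier M" "U = N +>\<^bsub>M\<^esub> z"
      using elim by meson
    then show "S \<oplus>\<^bsub>?Q\<^esub> T \<oplus>\<^bsub>?Q\<^esub> U = S \<oplus>\<^bsub>?Q\<^esub> (T \<oplus>\<^bsub>?Q\<^esub> U)"
      by (simp only: simps M.a_assoc)
  next
    fix S T
    assume "S \<in> carrier ?Q" "T \<in> carrier ?Q"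
    then obtain x y where xy: "x \<in> carrier M" "S = N +>\<^bsub>M\<^esub> x" "y \<in> carrier M" "T = N +>\<^bsub>M\<^esub> y"
      using elim by meson
    show "S \<oplus>\<^bsub>?Q\<^esub> T \<in> carrier ?Q"
      using xy by (simp only: simps)
    show "S \<oplus>\<^bsub>?Q\<^esub> T = T \<oplus>\<^bsub>?Q\<^esub> S"
      using xy M.a_comm[OF xy(1,3)] by (simp only: simps)
  next
    fix S
    assume "S \<in> carrier ?Q"
    then obtain x where x: "x \<in> carrier M" "S = N +>\<^bsub>M\<^esub> x"
      using elim by meson
    show "\<zero>\<^bsub>?Q\<^esub> \<oplus>\<^bsub>?Q\<^esub> S = S"
      unfolding zero using x M.zero_closed by (simp only: simps M.l_zero)
    have "(N +>\<^bsub>M\<^esub> (\<ominus>\<^bsub>M\<^esub> x)) \<oplus>\<^bsub>?Q\<^esub> S = \<zero>\<^bsub>?Q\<^esub>"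
      unfolding zero using x M.a_inv_closed[OF x(1)] by (simp only: simps M.l_neg)
    then show "\<exists>T\<in>carrier ?Q. T \<oplus>\<^bsub>?Q\<^esub> S = \<zero>\<^bsub>?Q\<^esub>"
      using coset x M.a_inv_closed by blast
  qed
  show "cring A" ..
  fix a b S T
  assume a: "a \<in> carrier A" "b \<in> carrier A" and "S \<in> carrier ?Q" "T \<in> carrier ?Q"
  then obtain x y where xy: "x \<in> carrier M" "S = N +>\<^bsub>M\<^esub> x" "y \<in> carrier M" "T = N +>\<^bsub>M\<^esub> y"
    using elim by meson
  show "a \<odot>\<^bsub>?Q\<^esub> S \<in> carrier ?Q"
    using a xy by (simp only: simps)
  show "(a \<oplus>\<^bsub>A\<^esub> b) \<odot>\<^bsub>?Q\<^esub> S = a \<odot>\<^bsub>?Q\<^esub> S \<oplus>\<^bsub>?Q\<^esub> b \<odot>\<^bsub>?Q\<^esub> S"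
    using a xy by (simp only: simps R.a_closed smult_l_distr)
  show "a \<odot>\<^bsub>?Q\<^esub> (S \<oplus>\<^bsub>?Q\<^esub> T) = a \<odot>\<^bsub>?Q\<^esub> S \<oplus>\<^bsub>?Q\<^esub> a \<odot>\<^bsub>?Q\<^esub> T"
    using a xy by (simp only: simps smult_r_distr)
  show "(a \<otimes>\<^bsub>A\<^esub> b) \<odot>\<^bsub>?Q\<^esub> S = a \<odot>\<^bsub>?Q\<^esub> (b \<odot>\<^bsub>?Q\<^esub> S)"
    using a xy by (simp only: simps R.m_closed smult_assoc1)
next
  fix S
  assume "S \<in> carrier (quotient_module M N)"
  then show "\<one>\<^bsub>A\<^esub> \<odot>\<^bsub>quotient_module M N\<^esub> S = S"
    unfolding quotient_module_carrier
    by (elim imageE) (simp only: quotient_module_smult R.one_closed smult_one)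
qed

end

text \<open>Closure under negation is closure under the scalar minus one.\<close>

lemma (in module) submoduleI_smult:
  assumes "H \<subseteq> carrier M" "\<zero>\<^bsub>M\<^esub> \<in> H" "\<And>x y. x \<in> H \<Longrightarrow> y \<in> H \<Longrightarrow> x \<oplus>\<^bsub>M\<^esub> y \<in> H"
    and smult: "\<And>a x. a \<in> carrier R \<Longrightarrow> x \<in> H \<Longrightarrow> a \<odot>\<^bsub>M\<^esub> x \<in> H"
  shows "submodule H R M"
proof (rule submoduleI)
  fix x
  assume "x \<in> H"
  then show "\<ominus>\<^bsub>M\<^esub> x \<in> H"
    using smult[of "\<ominus> \<one>" x] assms(1) smult_l_minus[of \<one> x] by auto
qed (use assms in auto)

section \<open>Finite indexed bases\<close>

text \<open>\<open>is_basis\<close> speaks of finite subsets, with coefficients attached to the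
  vectors. For a finite, injectively indexed family it is enough to consider sums over the whole
  index set: coefficients on a subset are extended by zero, and coefficients on \<open>T\<close> are
  carried to vectors by the inverse of \<open>b\<close>.\<close>

lemma is_basis_imageI:
  fixes R (structure) and M :: "('a, 'b) module" (structure)
  assumes M: "module R M" and T: "finite T" and inj: "inj_on b T" and b: "b \<in> T \<rightarrow> carrier M"
    and indep: "\<And>c. c \<in> T \<rightarrow> carrier R \<Longrightarrow> (\<Oplus>\<^bsub>M\<^esub>t\<in>T. c t \<odot>\<^bsub>M\<^esub> b t) = \<zero>\<^bsub>M\<^esub> \<Longrightarrow> \<forall>t\<in>T. c t = \<zero>"
    and span: "\<And>m. m \<in> carrier M \<Longrightarrow> \<exists>c\<in>T \<rightarrow> carrier R. m = (\<Oplus>\<^bsub>M\<^esub>t\<in>T. c t \<odot>\<^bsub>M\<^esub> b t)"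
  shows "is_basis R M (b ` T)"
proof -
  interpret module R M by fact
  show ?thesis
    unfolding is_basis_def lin_indep_def spanning_def
  proof (intro conjI allI impI ballI; (elim conjE)?)
    show "module R M" ..
    show "b ` T \<subseteq> carrier M"
      using b by auto
  next
    fix S c x
    assume S: "finite S" "S \<subseteq> b ` T" and c: "c \<in> S \<rightarrow> carrier R"
      and sum: "(\<Oplus>\<^bsub>M\<^esub>b\<in>S. c b \<odot>\<^bsub>M\<^esub> b) = \<zero>\<^bsub>M\<^esub>" and x: "x \<in> S"
    define c' where "c' t = (if b t \<in> S then c (b t) else \<zero>)" for t
    define T' where "T' = {t \<in> T. b t \<in> S}"
    have S_eq: "S = b ` T'"
      using S by (auto simp: T'_def)
    have c': "c' \<in> T \<rightarrow> carrier R"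
      using c by (auto simp: c'_def)
    have "(\<Oplus>\<^bsub>M\<^esub>t\<in>T. c' t \<odot>\<^bsub>M\<^esub> b t) = (\<Oplus>\<^bsub>M\<^esub>t\<in>T'. c (b t) \<odot>\<^bsub>M\<^esub> b t)"
      using T b c c' by (intro M.add.finprod_mono_neutral_cong_right) (auto simp: T'_def c'_def Pi_iff)
    also have "\<dots> = (\<Oplus>\<^bsub>M\<^esub>x\<in>S. c x \<odot>\<^bsub>M\<^esub> x)"
      unfolding S_eq using inj b c S
      by (intro M.add.finprod_reindex[symmetric]) (auto simp: T'_def inj_on_def)
    finally have "\<forall>t\<in>T. c' t = \<zero>"
      using indep c' sum by simp
    then show "c x = \<zero>"
      using x S by (force simp: c'_def)
  next
    fix m
    assume "m \<in> carrier M"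
    then obtain c where c: "c \<in> T \<rightarrow> carrier R" and m: "m = (\<Oplus>\<^bsub>M\<^esub>t\<in>T. c t \<odot>\<^bsub>M\<^esub> b t)"
      using span by blast
    have "m = (\<Oplus>\<^bsub>M\<^esub>t\<in>T. c (inv_into T b (b t)) \<odot>\<^bsub>M\<^esub> b t)"
      unfolding m using b c inj by (intro M.finsum_cong') (auto simp: Pi_iff)
    also have "\<dots> = (\<Oplus>\<^bsub>M\<^esub>x\<in>b ` T. c (inv_into T b x) \<odot>\<^bsub>M\<^esub> x)"
      using inj b c by (intro M.add.finprod_reindex[symmetric]) (auto simp: Pi_iff)
    finally show "\<exists>S c. finite S \<and> S \<subseteq> b ` T \<and> c \<in> S \<rightarrow> carrier R \<and> m = (\<Oplus>\<^bsub>M\<^esub>b\<in>S. c b \<odot>\<^bsub>M\<^esub> b)"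
      using T c inj by (intro exI[of _ "b ` T"] exI[of _ "\<lambda>x. c (inv_into T b x)"]) (auto simp: Pi_iff)
  qed
qed

section \<open>Modules with a greatest proper submodule\<close>

context
  fixes A :: "('a, 'm) ring_scheme" and M :: "('a, 'b) module" and N
  assumes M: "module A M" and N: "submodule N A M" "N \<noteq> carrier M"
    and greatest: "\<And>L. submodule L A M \<Longrightarrow> L \<noteq> carrier M \<Longrightarrow> L \<subseteq> N"
begin

interpretation module A M by (rule M)

text \<open>A maximal submodule lies in \<open>N\<close>, and as \<open>N\<close> is proper it
  equals \<open>N\<close>; so the intersection has the single member \<open>N\<close>.\<close>

lemma rad_eq_greatest_submodule: "rad A M = N"
proof -
  have "maximal_submodule N A M"
    using N greatest by (auto simp: maximal_submodule_def)
  moreover have "maximal_submodule L A M \<Longrightarrow> L = N" for L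
    using N greatest[of L] unfolding maximal_submodule_def by metis
  ultimately have "{L. maximal_submodule L A M} = {N}"
    by blast
  then show ?thesis
    using submoduleE(1)[OF N(1)] by (auto simp: rad_def)
qed

text \<open>Two nonzero submodules with zero intersection are both proper, hence both lie in
  \<open>N\<close>, and so does their sum, which is therefore not the whole module.\<close>

lemma indecomposable_greatest_submodule: "indecomposable A M"
proof -
  interpret N: submodule N A M by (rule N)
  have False if L: "submodule L A M" "L \<noteq> {\<zero>\<^bsub>M\<^esub>}" and L': "submodule L' A M" "L' \<noteq> {\<zero>\<^bsub>M\<^esub>}"
      and Int: "L \<inter> L' = {\<zero>\<^bsub>M\<^esub>}" and sum: "L <+>\<^bsub>M\<^esub> L' = carrier M" for L L'
  proof -
    have "L \<noteq> carrier M" "L' \<noteq> carrier M"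
      using submoduleE(1)[OF L(1)] submoduleE(1)[OF L'(1)] L L' Int by auto
    then have "L \<subseteq> N" "L' \<subseteq> N"
      using greatest L L' by auto
    then have "carrier M \<subseteq> N"
      unfolding sum[symmetric] set_add_def' using submoduleE(5)[OF N(1)] by blast
    then show False
      using N submoduleE(1) by auto
  qed
  moreover have "carrier M \<noteq> {\<zero>\<^bsub>M\<^esub>}"
    using N submoduleE(1)[OF N(1)] N.one_closed by auto
  ultimately show ?thesis
    using M by (auto simp: indecomposable_def)
qed

end

section \<open>Polynomials and jets\<close>

lemma dominates_induce_subgraph_iff:
  "dominates (G \<restriction> W) u v \<longleftrightarrow> dominates G u v \<and> u \<in> W \<and> v \<in> W"
  by (auto simp: arcs_ends_conv)

text \<open>\<open>pairwise\<close> skips the diagonal; in the absence of loops the diagonal may be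
  included, which gives a condition on all pairs.\<close>

lemma (in loopfree_digraph) independent_sets_induce_subgraph:
  "S \<in> independent_sets (G \<restriction> W) \<longleftrightarrow> S \<subseteq> W \<and> (\<forall>u\<in>S. \<forall>v\<in>S. \<not> dominates G u v)"
proof -
  have "\<not> dominates G u u" for u
    using no_loops by (auto simp: arcs_ends_conv)
  then show ?thesis
    unfolding independent_sets_def pairwise_def dominates_induce_subgraph_iff
      induce_subgraph_verts mem_Collect_eq by (metis subsetD)
qed

section \<open>The polynomial algebra on a set of variables\<close>

lemma polynomial_algebra_simps [simp]:
  "monoid.mult (polynomial_algebra V :: ('v, 'a::field) poly_in ring) = (*)"
  "one (polynomial_algebra V :: ('v, 'a) poly_in ring) = 1"
  "ring.zero (polynomial_algebra V :: ('v, 'a) poly_in ring) = 0"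
  "ring.add (polynomial_algebra V :: ('v, 'a) poly_in ring) = (+)"
  by (simp_all add: polynomial_algebra_def)

lemma polynomial_algebra_carrier:
  "p \<in> carrier (polynomial_algebra V) \<longleftrightarrow> (\<forall>m\<in>Poly_Mapping.keys p. Poly_Mapping.keys m \<subseteq> V)"
  by (simp add: polynomial_algebra_def)

context
  fixes V :: "'v set"
begin

abbreviation "poly_carrier \<equiv> carrier (polynomial_algebra V :: ('v, 'a::field) poly_in ring)"

lemma polynomial_algebra_closed [intro, simp]:
  fixes p q :: "('v, 'a::field) poly_in"
  shows "0 \<in> poly_carrier" "1 \<in> poly_carrier" "pconst c \<in> poly_carrier" "v \<in> V \<Longrightarrow> pvar v \<in> poly_carrier"
    "p \<in> poly_carrier \<Longrightarrow> q \<in> poly_carrier \<Longrightarrow> p + q \<in> poly_carrier"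
    "p \<in> poly_carrier \<Longrightarrow> q \<in> poly_carrier \<Longrightarrow> p * q \<in> poly_carrier"
    "p \<in> poly_carrier \<Longrightarrow> - p \<in> poly_carrier"
    "p \<in> poly_carrier \<Longrightarrow> q \<in> poly_carrier \<Longrightarrow> p - q \<in> poly_carrier"
proof -
  show "0 \<in> poly_carrier" "1 \<in> poly_carrier" "pconst c \<in> poly_carrier" "v \<in> V \<Longrightarrow> pvar v \<in> poly_carrier"
    by (auto simp: polynomial_algebra_carrier pconst_def pvar_def)
  show add: "p + q \<in> poly_carrier" if "p \<in> poly_carrier" "q \<in> poly_carrier" for p q :: "('v, 'a) poly_in"
    using that keys_add[of p q] by (auto simp: polynomial_algebra_carrier)
  show minus: "- p \<in> poly_carrier" if "p \<in> poly_carrier" for p :: "('v, 'a) poly_in"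
    using that by (auto simp: polynomial_algebra_carrier in_keys_iff)
  show "p - q \<in> poly_carrier" if "p \<in> poly_carrier" "q \<in> poly_carrier"
    using add[OF that(1) minus[OF that(2)]] by simp
  show "p * q \<in> poly_carrier" if "p \<in> poly_carrier" "q \<in> poly_carrier"
    unfolding polynomial_algebra_carrier
  proof
    fix m
    assume "m \<in> Poly_Mapping.keys (p * q)"
    then obtain a b where "a \<in> Poly_Mapping.keys p" "b \<in> Poly_Mapping.keys q" "m = a + b"
      using keys_mult[of p q] by auto
    then show "Poly_Mapping.keys m \<subseteq> V"
      using that keys_add[of a b] by (auto simp: polynomial_algebra_carrier dest!: subsetD[of "Poly_Mapping.keys (a + b)"])
  qed
qed

lemma polynomial_algebra_sum_closed [intro]: "(\<And>i. i \<in> S \<Longrightarrow> f i \<in> poly_carrier) \<Longrightarrow> sum f S \<in> poly_carrier"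
  by (induction S rule: infinite_finite_induct) auto

lemma polynomial_algebra_prod_closed [intro]: "(\<And>i. i \<in> S \<Longrightarrow> f i \<in> poly_carrier) \<Longrightarrow> prod f S \<in> poly_carrier"
  by (induction S rule: infinite_finite_induct) auto

lemma cring_polynomial_algebra: "cring (polynomial_algebra V :: ('v, 'a::field) poly_in ring)"
proof (intro cringI abelian_groupI comm_monoidI)
  show "\<exists>q\<in>poly_carrier. q \<oplus>\<^bsub>polynomial_algebra V\<^esub> p = \<zero>\<^bsub>polynomial_algebra V\<^esub>"
    if "p \<in> poly_carrier" for p :: "('v, 'a) poly_in"
    using that by (intro bexI[of _ "- p"]) auto
qed (auto simp: algebra_simps)

lemma polynomial_algebra_a_inv:
  assumes "p \<in> poly_carrier"
  shows "\<ominus>\<^bsub>polynomial_algebra V\<^esub> p = - p"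
proof -
  interpret cring "polynomial_algebra V :: ('v, 'a::field) poly_in ring"
    by (rule cring_polynomial_algebra)
  show ?thesis
    using assms by (intro minus_equality) auto
qed

lemma polynomial_algebra_minus:
  assumes "p \<in> poly_carrier" "q \<in> poly_carrier"
  shows "p \<ominus>\<^bsub>polynomial_algebra V\<^esub> q = p - q"
  using assms by (simp add: a_minus_def polynomial_algebra_a_inv)

end

lemma pconst_zero [simp]: "pconst 0 = 0"
  by (simp add: pconst_def)

lemma pconst_simps:
  "pconst (c + d) = pconst c + pconst d" "pconst (c * d) = pconst c * pconst d" "pconst 1 = 1"
  by (simp_all add: pconst_def single_add mult_single)

text \<open>Every polynomial is a finite sum of monomials. The monomials that occur stay among those
  of \<open>p\<close>, so that a restriction on the variables of \<open>p\<close> is available in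
  each case.\<close>

lemma poly_mapping_induct_add [case_names single add zero]:
  fixes p :: "'a \<Rightarrow>\<^sub>0 'b::comm_monoid_add"
  assumes "\<And>m c. m \<in> Poly_Mapping.keys p \<Longrightarrow> P (Poly_Mapping.single m c)"
    and "\<And>q r. Poly_Mapping.keys q \<subseteq> Poly_Mapping.keys p \<Longrightarrow> Poly_Mapping.keys r \<subseteq> Poly_Mapping.keys p
      \<Longrightarrow> P q \<Longrightarrow> P r \<Longrightarrow> P (q + r)" and "P 0"
  shows "P p"
proof -
  have "P q" if "Poly_Mapping.keys q \<subseteq> Poly_Mapping.keys p" for q
    using that
  proof (induction q rule: update_induct)
    case const
    then show ?case
      using assms(3) by simp
  next
    case (update q m c)
    have "Poly_Mapping.update m c q = Poly_Mapping.single m c + q"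
      using update(1) by (intro poly_mapping_eqI)
        (auto simp: lookup_update lookup_add lookup_single in_keys_iff when_def)
    moreover have "Poly_Mapping.keys (Poly_Mapping.update m c q) = insert m (Poly_Mapping.keys q)"
      using update(2) by (auto simp: keys_update)
    ultimately show ?case
      using update assms by auto
  qed
  then show ?thesis
    by blast
qed

lemma pvar_mult_single:
  "pvar v * Poly_Mapping.single m c = Poly_Mapping.single (Poly_Mapping.single v 1 + m) c"
  by (simp add: pvar_def mult_single)

text \<open>A monomial arises from a constant by successive multiplication with variables, and a
  polynomial is a sum of monomials. The rule reduces statements on products and jets to
  multiplication by a single variable.\<close>

lemma polynomial_algebra_induct [consumes 1, case_names const add var]:
  fixes p :: "('v, 'a::field) poly_in"
  assumes p: "p \<in> carrier (polynomial_algebra V)"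
    and const: "\<And>c. P (pconst c)"
    and add: "\<And>p q. p \<in> carrier (polynomial_algebra V) \<Longrightarrow> q \<in> carrier (polynomial_algebra V)
      \<Longrightarrow> P p \<Longrightarrow> P q \<Longrightarrow> P (p + q)"
    and var: "\<And>v p. v \<in> V \<Longrightarrow> p \<in> carrier (polynomial_algebra V) \<Longrightarrow> P p \<Longrightarrow> P (pvar v * p)"
  shows "P p"
proof -
  have monomial: "P (Poly_Mapping.single m c)" if "Poly_Mapping.keys m \<subseteq> V" for m c
    using that
  proof (induction m rule: update_induct)
    case const
    then show ?case
      using assms(2)[of c] by (simp add: pconst_def)
  next
    case (update m v k)
    have upd: "Poly_Mapping.update v k m = Poly_Mapping.single v k + m"
      using update(1) by (intro poly_mapping_eqI)
        (auto simp: lookup_update lookup_add lookup_single in_keys_iff when_def)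
    have V: "v \<in> V" "Poly_Mapping.keys m \<subseteq> V"
      using update.prems update(2) by (auto simp: keys_update)
    \<comment> \<open>The power of the new variable is built up one factor \<open>pvar v\<close> at
      a time.\<close>
    have "P (Poly_Mapping.single (Poly_Mapping.single v k + m) c)"
    proof (induction k)
      case 0
      then show ?case
        using update.IH V by simp
    next
      case (Suc k)
      have "Poly_Mapping.single (Poly_Mapping.single v (Suc k) + m) c =
          pvar v * Poly_Mapping.single (Poly_Mapping.single v k + m) c"
        by (simp add: pvar_mult_single flip: single_add add.assoc)
      moreover have "Poly_Mapping.single (Poly_Mapping.single v k + m) c \<in> carrier (polynomial_algebra V)"
        using V keys_add[of "Poly_Mapping.single v k" m]
        by (auto simp: polynomial_algebra_carrier split: if_splits)
      ultimately show ?case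
        using Suc var V by simp
    qed
    then show ?case
      by (simp add: upd)
  qed
  show ?thesis
  proof (induction p rule: poly_mapping_induct_add)
    case (single m c)
    then show ?case
      using p monomial[of m c] by (auto simp: polynomial_algebra_carrier)
  next
    case (add q r)
    then show ?case
      using p by (intro assms(3)) (auto simp: polynomial_algebra_carrier)
  next
    case zero
    then show ?case
      using const[of 0] by (simp add: pconst_def)
  qed
qed

section \<open>Jets of polynomials\<close>

text \<open>
  Monomials with a \<open>J\<close>-exponent above 1 do not contribute, whereas the exponents on \<open>I\<close> are arbitrary.
\<close>

definition jet :: "'v set \<Rightarrow> 'v set \<Rightarrow> ('v, 'a::field) poly_in \<Rightarrow> 'a" where
  "jet I J p = (\<Sum>m\<in>Poly_Mapping.keys p. Poly_Mapping.lookup p m when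
     Poly_Mapping.keys m \<subseteq> I \<union> J \<and> (\<forall>v\<in>J. Poly_Mapping.lookup m v = 1))"

lemma jet_zero [simp]: "jet I J 0 = 0"
  by (simp add: jet_def)

text \<open>Cancellation can make the keys of \<open>p + q\<close> fewer than those of
  \<open>p\<close> and \<open>q\<close> together; monomials with coefficient zero contribute zero,
  so the sums still agree.\<close>

lemma jet_add [simp]: "jet I J (p + q) = jet I J p + jet I J q"
  unfolding jet_def
  by (rule setsum_keys_plus_distrib[of "\<lambda>m c. c when _ m"]) (auto simp: when_add_distrib)

lemma jet_single:
  "jet I J (Poly_Mapping.single m c) =
     (c when Poly_Mapping.keys m \<subseteq> I \<union> J \<and> (\<forall>v\<in>J. Poly_Mapping.lookup m v = 1))"
  by (simp add: jet_def)

lemma jet_sum: "jet I J (sum f S) = (\<Sum>i\<in>S. jet I J (f i))"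
  by (induction S rule: infinite_finite_induct) auto

lemma jet_pconst_mult [simp]: "jet I J (pconst c * p) = c * jet I J p"
proof (induction p rule: poly_mapping_induct_add)
  case (single m d)
  then show ?case
    by (simp add: pconst_def mult_single jet_single mult_when)
qed (simp_all add: distrib_left)

lemma jet_pconst [simp]: "jet I J (pconst c) = (if J = {} then c else 0)"
  by (auto simp: pconst_def jet_single)

lemma jet_one [simp]: "jet I J 1 = (if J = {} then 1 else 0)"
  using jet_pconst[of I J 1] by (simp add: pconst_def)

lemma jet_minus [simp]: "jet I J (p - q) = jet I J p - jet I J q"
  using jet_add[of I J "p - q" q] by simp

text \<open>On a monomial: for \<open>v \<in> I\<close> the exponent of \<open>v\<close> is free, so
  the factor changes nothing. For \<open>v \<in> J\<close> the product has exponent 1 exactly if the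
  monomial does not contain \<open>v\<close>, which moves \<open>v\<close> out of \<open>J\<close>.
  Any other \<open>v\<close> is set to zero.\<close>

lemma jet_pvar_mult:
  assumes "I \<inter> J = {}"
  shows "jet I J (pvar v * p) =
    (if v \<in> I then jet I J p else if v \<in> J then jet I (J - {v}) p else 0)"
proof (induction p rule: poly_mapping_induct_add)
  case (single m c)
  have keys: "Poly_Mapping.keys (Poly_Mapping.single v 1 + m) = insert v (Poly_Mapping.keys m)"
    by (auto simp: in_keys_iff lookup_add lookup_single when_def split: if_splits)
  have lookup: "Poly_Mapping.lookup (Poly_Mapping.single v 1 + m) u =
      (if u = v then Suc (Poly_Mapping.lookup m u) else Poly_Mapping.lookup m u)" for u
    by (auto simp: lookup_add lookup_single when_def)
  have keys_iff: "u \<in> Poly_Mapping.keys m \<longleftrightarrow> Poly_Mapping.lookup m u \<noteq> 0" for u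
    by (rule in_keys_iff)
  consider "v \<in> I" "v \<notin> J" | "v \<notin> I" "v \<in> J" | "v \<notin> I \<union> J"
    using assms by blast
  then show ?case
  proof cases
    case 1
    then have "(\<forall>u\<in>J. (if u = v then Suc (Poly_Mapping.lookup m u) else Poly_Mapping.lookup m u) = 1)
        \<longleftrightarrow> (\<forall>u\<in>J. Poly_Mapping.lookup m u = 1)"
      by (intro ball_cong) auto
    with 1 show ?thesis
      unfolding pvar_mult_single jet_single keys lookup by simp
  next
    case 2
    then obtain J' where J': "J = insert v J'" "v \<notin> J'" "J - {v} = J'"
      by (metis Diff_insert_absorb mk_disjoint_insert)
    have "(\<forall>u\<in>J'. (if u = v then Suc (Poly_Mapping.lookup m u) else Poly_Mapping.lookup m u) = 1)
        \<longleftrightarrow> (\<forall>u\<in>J'. Poly_Mapping.lookup m u = 1)"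
      using J'(2) by (intro ball_cong) auto
    moreover have "v \<notin> Poly_Mapping.keys m \<and> Poly_Mapping.keys m \<subseteq> I \<union> insert v J'
        \<longleftrightarrow> Poly_Mapping.keys m \<subseteq> I \<union> J'"
      using 2 J'(2) by blast
    ultimately have "insert v (Poly_Mapping.keys m) \<subseteq> I \<union> J \<and>
        (\<forall>u\<in>J. (if u = v then Suc (Poly_Mapping.lookup m u) else Poly_Mapping.lookup m u) = 1)
        \<longleftrightarrow> Poly_Mapping.keys m \<subseteq> I \<union> J' \<and> (\<forall>u\<in>J'. Poly_Mapping.lookup m u = 1)"
      unfolding J'(1) using keys_iff[of v] by simp blast
    with 2 show ?thesis
      unfolding pvar_mult_single jet_single keys lookup J'(3) by simp
  next
    case 3
    then show ?thesis
      unfolding pvar_mult_single jet_single keys lookup by simp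
  qed
qed (simp_all add: distrib_left)

text \<open>For empty \<open>J\<close> the jet is evaluation at the indicator function of
  \<open>I\<close>, hence multiplicative.\<close>

lemma jet_empty_mult: "jet I {} (p * q) = jet I {} p * jet I {} q"
proof -
  have "p \<in> carrier (polynomial_algebra UNIV)"
    by (simp add: polynomial_algebra_carrier)
  then show ?thesis
    by (induction p rule: polynomial_algebra_induct) (simp_all add: jet_pvar_mult mult.assoc distrib_right)
qed

lemma jet_prod_pvar_subset:
  assumes "I \<inter> J = {}" "K \<subseteq> I"
  shows "jet I J ((\<Prod>v\<in>K. pvar v) * p) = jet I J p"
  using assms(2) by (induction K rule: infinite_finite_induct)
    (simp_all add: jet_pvar_mult[OF assms(1)] mult.assoc)

text \<open>Each factor strikes its own variable off \<open>J\<close>; a variable of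
  \<open>K\<close> outside \<open>J\<close> lies outside \<open>I\<close> as well and gives
  zero.\<close>

lemma jet_prod_pvar_disjoint:
  assumes "I \<inter> J = {}" "K \<inter> I = {}" "finite K"
  shows "jet I J ((\<Prod>v\<in>K. pvar v) * p) = (if K \<subseteq> J then jet I (J - K) p else 0)"
  using assms(3,1,2)
proof (induction K arbitrary: J)
  case (insert v K)
  have "J - insert v K = J - {v} - K" "I \<inter> (J - {v}) = {}"
    using insert by auto
  then show ?case
    using insert insert.IH[of "J - {v}"] by (auto simp: jet_pvar_mult mult.assoc)
qed simp

text \<open>The jet sets the variables of \<open>L\<close> to zero, so each factor acts as
  1.\<close>

lemma jet_prod_one_minus:
  assumes "I \<inter> J = {}" "L \<inter> (I \<union> J) = {}"
  shows "jet I J ((\<Prod>v\<in>L. 1 - pvar v) * p) = jet I J p"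
  using assms(2) by (induction L rule: infinite_finite_induct)
    (simp_all add: jet_pvar_mult[OF assms(1)] mult.assoc left_diff_distrib)

lemma jet_pvar:
  assumes "I \<inter> J = {}"
  shows "jet I J (pvar v) = (if v \<in> I then jet I J 1 else if v \<in> J then jet I (J - {v}) 1 else 0)"
  using jet_pvar_mult[OF assms, of v 1] by simp

section \<open>The ideal of relations\<close>

locale graph_with_squares = graph G for G :: "('v, 'e) pre_digraph" +
  fixes R :: "'v set"
  assumes R_subset: "R \<subseteq> verts G"
begin

abbreviation "idx \<equiv> independent_sets (G \<restriction> (verts G - R))"
abbreviation "jdx I \<equiv> independent_sets (G \<restriction> (R - neighbours G I))"
abbreviation "polys \<equiv> carrier (polynomial_algebra (verts G) :: ('v, 'a::field) poly_in ring)"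

lemma idx_iff: "I \<in> idx \<longleftrightarrow> I \<subseteq> verts G - R \<and> (\<forall>u\<in>I. \<forall>v\<in>I. \<not> dominates G u v)"
  by (rule independent_sets_induce_subgraph)

lemma jdx_iff: "J \<in> jdx I \<longleftrightarrow>
    J \<subseteq> R \<and> (\<forall>u\<in>I. \<forall>v\<in>J. \<not> dominates G u v) \<and> (\<forall>u\<in>J. \<forall>v\<in>J. \<not> dominates G u v)"
  unfolding independent_sets_induce_subgraph by (auto simp: neighbours_def)

lemma dominates_sym: "dominates G u v \<Longrightarrow> dominates G v u"
  using sym_arcs by (auto simp: symmetric_def sym_def)

lemma dominates_verts: "dominates G u v \<Longrightarrow> u \<in> verts G \<and> v \<in> verts G"
  by (auto simp: arcs_ends_conv)

lemma finite_idx: "finite idx"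
  by (rule finite_subset[of _ "Pow (verts G)"]) (auto simp: idx_iff)

lemma finite_R: "finite R"
  using R_subset finite_verts finite_subset by blast

lemma finite_jdx: "finite (jdx I)"
  by (rule finite_subset[of _ "Pow R"]) (auto simp: jdx_iff finite_R)

lemma idx_jdx_disjoint: "I \<in> idx \<Longrightarrow> J \<in> jdx I \<Longrightarrow> I \<inter> J = {}"
  by (auto simp: idx_iff jdx_iff)

lemma jdx_subset: "J \<in> jdx I \<Longrightarrow> J' \<subseteq> J \<Longrightarrow> J' \<in> jdx I"
  unfolding jdx_iff by (meson subsetD subset_trans)

lemma empty_jdx: "{} \<in> jdx I"
  by (auto simp: jdx_iff)

section \<open>Vanishing of jets on the ideal\<close>

interpretation Poly: cring "polynomial_algebra (verts G) :: ('v, 'a::field) poly_in ring"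
  by (rule cring_polynomial_algebra)

abbreviation gens :: "('v, 'a::field) poly_in set" where
  "gens \<equiv> {pvar r ^ 2 | r. r \<in> R} \<union> {pvar v ^ 2 - pvar v | v. v \<in> verts G - R} \<union>
     {pvar u * pvar v | u v. dominates G u v}"

lemma gens_polys: "gens \<subseteq> (polys :: ('v, 'a::field) poly_in set)"
  using R_subset dominates_verts by (auto simp: power2_eq_square)

lemma ideal_H_ideal: "ideal (H_ideal G R :: ('v, 'a::field) poly_in set) (polynomial_algebra (verts G))"
  unfolding H_ideal_def by (rule Poly.genideal_ideal[OF gens_polys])

lemma gens_H_ideal: "gens \<subseteq> (H_ideal G R :: ('v, 'a::field) poly_in set)"
  unfolding H_ideal_def by (rule Poly.genideal_self[OF gens_polys])

interpretation HI: ideal "H_ideal G R :: ('v, 'a::field) poly_in set" "polynomial_algebra (verts G)"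
  by (rule ideal_H_ideal)

text \<open>Multiplication by \<open>x_v\<close> turns the jet at \<open>(I, J)\<close> into itself,
  into the jet at \<open>(I, J - {v})\<close> or into zero, and \<open>jdx I\<close> is closed under
  subsets. All jets have to be treated at once because \<open>J\<close> shrinks.\<close>

lemma jets_vanish_mult:
  fixes p q :: "('v, 'a::field) poly_in"
  assumes "q \<in> polys" and "\<forall>I\<in>idx. \<forall>J\<in>jdx I. jet I J p = 0"
  shows "\<forall>I\<in>idx. \<forall>J\<in>jdx I. jet I J (q * p) = 0"
  using assms(1)
proof (induction q rule: polynomial_algebra_induct)
  case (var v q)
  have "J - {v} \<in> jdx I" if "J \<in> jdx I" for I J
    using jdx_subset[OF that] by blast
  with var show ?case
    by (simp add: jet_pvar_mult idx_jdx_disjoint mult.assoc)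
qed (simp_all add: assms(2) distrib_right)

text \<open>For \<open>r \<in> R\<close> the square has exponent 2, which no \<open>J\<close>
  admits, and \<open>r\<close> is not in \<open>I\<close>. A variable outside \<open>R\<close> is
  set to 0 or 1, both idempotent. An edge never has both ends in \<open>I \<union> J\<close>, so one
  factor of its monomial is set to zero.\<close>

lemma jets_vanish_gens:
  fixes p :: "('v, 'a::field) poly_in"
  assumes "p \<in> gens" "I \<in> idx" "J \<in> jdx I"
  shows "jet I J p = 0"
proof -
  have disj: "I \<inter> J = {}" "\<And>v. I \<inter> (J - {v}) = {}"
    using assms idx_jdx_disjoint by auto
  show ?thesis
    using assms(1)
  proof (elim UnE CollectE exE conjE)
    fix r assume "p = pvar r ^ 2" "r \<in> R"
    then show ?thesis
      using assms(2) disj by (auto simp: power2_eq_square jet_pvar_mult jet_pvar idx_iff)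
  next
    fix v assume "p = pvar v ^ 2 - pvar v" "v \<in> verts G - R"
    then show ?thesis
      using assms disj by (auto simp: power2_eq_square jet_pvar_mult jet_pvar jdx_iff)
  next
    fix u v assume "p = pvar u * pvar v" and uv: "dominates G u v"
    then show ?thesis
      using assms(2,3) disj dominates_sym[OF uv]
      by (auto simp: jet_pvar_mult jet_pvar jdx_iff idx_iff)
  qed
qed

text \<open>The common kernel \<open>K\<close> of the jets is an ideal containing the generators,
  and \<open>H_ideal\<close> is the least such ideal. Hence jets are well defined on the
  quotient.\<close>

lemma jet_H_ideal:
  fixes p :: "('v, 'a::field) poly_in"
  assumes "p \<in> H_ideal G R" "I \<in> idx" "J \<in> jdx I"
  shows "jet I J p = 0"
proof -
  define K :: "('v, 'a) poly_in set" where "K = {p \<in> polys. \<forall>I\<in>idx. \<forall>J\<in>jdx I. jet I J p = 0}"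
  have neg: "jet I J (- p) = - jet I J p" for I J and p :: "('v, 'a) poly_in"
    using jet_minus[of I J 0 p] by simp
  have "ideal K (polynomial_algebra (verts G))"
  proof (rule idealI)
    show "subgroup K (add_monoid (polynomial_algebra (verts G)))"
    proof (rule Poly.add.subgroupI)
      show "K \<subseteq> polys"
        by (auto simp: K_def)
      have "0 \<in> K"
        by (simp add: K_def)
      then show "K \<noteq> {}"
        by blast
    next
      fix p :: "('v, 'a) poly_in"
      assume p: "p \<in> K"
      then show "\<ominus>\<^bsub>polynomial_algebra (verts G)\<^esub> p \<in> K"
        using neg by (simp add: K_def polynomial_algebra_a_inv)
      show "p \<oplus>\<^bsub>polynomial_algebra (verts G)\<^esub> q \<in> K" if "q \<in> K" for q
        using p that by (simp add: K_def)
    qed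
  next
    fix a x :: "('v, 'a) poly_in"
    assume "a \<in> K" and "x \<in> carrier (polynomial_algebra (verts G) :: ('v, 'a) poly_in ring)"
    then show "x \<otimes>\<^bsub>polynomial_algebra (verts G)\<^esub> a \<in> K" "a \<otimes>\<^bsub>polynomial_algebra (verts G)\<^esub> x \<in> K"
      using jets_vanish_mult[of x a] by (auto simp: K_def mult.commute)
  qed (rule Poly.ring_axioms)
  moreover have "gens \<subseteq> K"
  proof
    fix p :: "('v, 'a) poly_in"
    assume p: "p \<in> gens"
    show "p \<in> K"
      unfolding K_def using gens_polys[THEN subsetD, OF p] jets_vanish_gens[OF p] by blast
  qed
  ultimately have "H_ideal G R \<subseteq> K"
    unfolding H_ideal_def by (rule Poly.genideal_minimal)
  then show ?thesis
    using assms by (auto simp: K_def)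
qed

text \<open>Congruence modulo the ideal, which keeps calculations in the quotient at the level of
  polynomials.\<close>

definition heq :: "('v, 'a::field) poly_in \<Rightarrow> ('v, 'a) poly_in \<Rightarrow> bool" (infix "\<sim>\<^sub>H" 50) where
  "p \<sim>\<^sub>H q \<longleftrightarrow> p - q \<in> H_ideal G R"

lemma H_ideal_closed:
  fixes p q :: "('v, 'a::field) poly_in"
  shows "0 \<in> (H_ideal G R :: ('v, 'a::field) poly_in set)"
    "p \<in> H_ideal G R \<Longrightarrow> q \<in> H_ideal G R \<Longrightarrow> p + q \<in> H_ideal G R"
    "p \<in> H_ideal G R \<Longrightarrow> - p \<in> H_ideal G R"
    "p \<in> polys \<Longrightarrow> q \<in> H_ideal G R \<Longrightarrow> p * q \<in> H_ideal G R"
    "p \<in> polys \<Longrightarrow> q \<in> H_ideal G R \<Longrightarrow> q * p \<in> H_ideal G R"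
    "p \<in> H_ideal G R \<Longrightarrow> p \<in> polys"
proof -
  show polys: "p \<in> H_ideal G R \<Longrightarrow> p \<in> polys" for p :: "('v, 'a::field) poly_in"
    by (rule HI.a_Hcarr)
  show "0 \<in> (H_ideal G R :: ('v, 'a::field) poly_in set)"
    using HI.zero_closed by simp
  show "p + q \<in> H_ideal G R" if "p \<in> H_ideal G R" "q \<in> H_ideal G R"
    using HI.a_closed[OF that] by simp
  show "- p \<in> H_ideal G R" if "p \<in> H_ideal G R"
    using HI.a_inv_closed[OF that] polynomial_algebra_a_inv[OF polys[OF that]] by simp
  show "p * q \<in> H_ideal G R" if "p \<in> polys" "q \<in> H_ideal G R"
    using HI.I_l_closed[OF that(2,1)] by simp
  show "q * p \<in> H_ideal G R" if "p \<in> polys" "q \<in> H_ideal G R"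
    using HI.I_r_closed[OF that(2,1)] by simp
qed

lemma heq_refl [intro, simp]: "p \<sim>\<^sub>H p"
  by (simp add: heq_def H_ideal_closed)

lemma heq_sym: "p \<sim>\<^sub>H q \<Longrightarrow> q \<sim>\<^sub>H p"
  using H_ideal_closed(3)[of "p - q"] by (simp add: heq_def)

lemma heq_trans [trans]: "p \<sim>\<^sub>H q \<Longrightarrow> q \<sim>\<^sub>H r \<Longrightarrow> p \<sim>\<^sub>H r"
  using H_ideal_closed(2)[of "p - q" "q - r"] by (simp add: heq_def)

lemma heq_add: "p \<sim>\<^sub>H q \<Longrightarrow> p' \<sim>\<^sub>H q' \<Longrightarrow> p + p' \<sim>\<^sub>H q + q'"
  using H_ideal_closed(2)[of "p - q" "p' - q'"] by (simp add: heq_def algebra_simps)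

lemma heq_sum: "(\<And>i. i \<in> S \<Longrightarrow> f i \<sim>\<^sub>H g i) \<Longrightarrow> sum f S \<sim>\<^sub>H sum g S"
  by (induction S rule: infinite_finite_induct) (auto intro: heq_add)

lemma heq_mult: "r \<in> polys \<Longrightarrow> p \<sim>\<^sub>H q \<Longrightarrow> r * p \<sim>\<^sub>H r * q"
  using H_ideal_closed(4)[of r "p - q"] by (simp add: heq_def algebra_simps)

lemma heq_mult_right: "p \<sim>\<^sub>H q \<Longrightarrow> r \<in> polys \<Longrightarrow> p * r \<sim>\<^sub>H q * r"
  using heq_mult[of r p q] by (simp add: mult.commute)

text \<open>The cofactor \<open>q\<close> and the nesting to the right let the relation apply to two
  leading variables of a longer product; the next two lemmas have the same form.\<close>

lemma pvar_square:
  assumes "r \<in> R" "q \<in> polys"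
  shows "pvar r * (pvar r * q) \<sim>\<^sub>H 0"
proof -
  have "pvar r ^ 2 \<sim>\<^sub>H 0"
    unfolding heq_def using gens_H_ideal assms by (simp, blast)
  from heq_mult_right[OF this assms(2)] show ?thesis
    by (simp add: power2_eq_square mult.assoc)
qed

lemma pvar_idem:
  assumes "v \<in> verts G - R" "q \<in> polys"
  shows "pvar v * (pvar v * q) \<sim>\<^sub>H pvar v * q"
proof -
  have "pvar v ^ 2 \<sim>\<^sub>H pvar v"
    unfolding heq_def using gens_H_ideal assms by blast
  from heq_mult_right[OF this assms(2)] show ?thesis
    by (simp add: power2_eq_square mult.assoc)
qed

lemma pvar_edge:
  assumes "dominates G u v" "q \<in> polys"
  shows "pvar u * (pvar v * q) \<sim>\<^sub>H 0"
proof -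
  have "pvar u * pvar v \<sim>\<^sub>H 0"
    unfolding heq_def using gens_H_ideal assms by (simp, blast)
  from heq_mult_right[OF this assms(2)] show ?thesis
    by (simp add: mult.assoc)
qed

end

section \<open>Orthogonal idempotents\<close>

context graph_with_squares
begin

section \<open>The idempotents and their jets\<close>

text \<open>A polynomial representing \<open>e_I\<close>. It makes sense for every \<open>I\<close>,
  so that the product of the sums \<open>x_v + (1 - x_v)\<close> can be expanded over all
  subsets.\<close>

definition idem :: "'v set \<Rightarrow> ('v, 'a::field) poly_in" where
  "idem I = (\<Prod>v\<in>I. pvar v) * (\<Prod>v\<in>verts G - R - I. 1 - pvar v)"

lemma prod_pvar_polys: "K \<subseteq> verts G \<Longrightarrow> (\<Prod>v\<in>K. pvar v) \<in> polys"
  by (rule polynomial_algebra_prod_closed) auto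

lemma prod_one_minus_polys: "K \<subseteq> verts G \<Longrightarrow> (\<Prod>v\<in>K. 1 - pvar v) \<in> polys"
  by (rule polynomial_algebra_prod_closed) auto

lemma idem_polys: "I \<subseteq> verts G \<Longrightarrow> idem I \<in> polys"
  unfolding idem_def
  by (intro polynomial_algebra_closed(6) prod_pvar_polys prod_one_minus_polys) auto

lemma idem_factor_in:
  assumes "I \<subseteq> verts G" "v \<in> I"
  obtains q where "q \<in> polys" "idem I = pvar v * q"
proof
  have "finite I"
    using assms finite_verts finite_subset by blast
  then show "idem I = pvar v * ((\<Prod>u\<in>I - {v}. pvar u) * (\<Prod>u\<in>verts G - R - I. 1 - pvar u))"
    using assms by (simp add: idem_def prod.remove[of I v] mult.assoc)
  show "(\<Prod>u\<in>I - {v}. pvar u) * (\<Prod>u\<in>verts G - R - I. 1 - pvar u) \<in> polys"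
    using assms by (intro polynomial_algebra_closed(6) prod_pvar_polys prod_one_minus_polys) auto
qed

lemma idem_factor_out:
  assumes "I \<subseteq> verts G" "v \<in> verts G - R - I"
  obtains q where "q \<in> polys" "idem I = (1 - pvar v) * q"
proof
  let ?L = "verts G - R - I"
  have "finite ?L"
    by simp
  then show "idem I = (1 - pvar v) * ((\<Prod>u\<in>I. pvar u) * (\<Prod>u\<in>?L - {v}. 1 - pvar u))"
    unfolding idem_def by (subst prod.remove[OF _ assms(2)]) (simp_all add: mult_ac)
  show "(\<Prod>u\<in>I. pvar u) * (\<Prod>u\<in>?L - {v}. 1 - pvar u) \<in> polys"
    using assms by (intro polynomial_algebra_closed(6) prod_pvar_polys prod_one_minus_polys) auto
qed

text \<open>On jets, multiplication by \<open>idem I\<close> is the projection to the index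
  \<open>I\<close>. If \<open>I = I'\<close>, every factor of \<open>idem I\<close> acts as 1;
  otherwise a vertex in just one of \<open>I\<close> and \<open>I'\<close> provides a factor that
  acts as 0.\<close>

lemma jet_mult_idem:
  fixes p :: "('v, 'a::field) poly_in"
  assumes "I \<in> idx" "I' \<in> idx" "J \<in> jdx I'"
  shows "jet I' J (p * idem I) = (if I = I' then jet I' J p else 0)"
proof -
  have disj: "I' \<inter> J = {}"
    using assms idx_jdx_disjoint by blast
  have vIJ: "I \<subseteq> verts G" "v \<in> I \<Longrightarrow> v \<notin> J" "v \<in> I' \<Longrightarrow> v \<in> verts G - R" for v
    using assms by (auto simp: idx_iff jdx_iff)
  consider "I = I'" | v where "v \<in> I" "v \<notin> I'" | v where "v \<notin> I" "v \<in> I'"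
    by blast
  then show ?thesis
  proof cases
    case 1
    have "(verts G - R - I') \<inter> (I' \<union> J) = {}"
      using assms by (auto simp: jdx_iff)
    moreover have "p * idem I' = (\<Prod>v\<in>I'. pvar v) * ((\<Prod>v\<in>verts G - R - I'. 1 - pvar v) * p)"
      by (simp add: idem_def mult_ac)
    ultimately show ?thesis
      using 1 disj by (simp add: jet_prod_pvar_subset jet_prod_one_minus)
  next
    case 2
    then obtain q :: "('v, 'a) poly_in" where q: "idem I = pvar v * q"
      using idem_factor_in[OF vIJ(1)] by metis
    have "p * idem I = pvar v * (p * q)"
      by (simp add: q mult_ac)
    then show ?thesis
      using 2(2) vIJ(2)[OF 2(1)] disj by (metis 2(1) jet_pvar_mult)
  next
    case 3
    then obtain q :: "('v, 'a) poly_in" where q: "idem I = (1 - pvar v) * q"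
      using idem_factor_out[OF vIJ(1), of v] vIJ(3)[of v] by blast
    have "p * idem I = p * q - pvar v * (p * q)"
      by (simp add: q algebra_simps)
    then show ?thesis
      using 3 jet_pvar_mult[OF disj, of v "p * q"] by (metis diff_self jet_minus)
  qed
qed

text \<open>For fixed \<open>I\<close> the jets form the dual family of the \<open>X_J e_I\<close>:
  the variables of \<open>J\<close> must lie in \<open>J'\<close> and exhaust it, since the jet of 1
  is nonzero only at the empty set.\<close>

lemma jet_prod_pvar_mult_idem:
  assumes "I \<in> idx" "J \<in> jdx I" "J' \<in> jdx I"
  shows "jet I J' ((\<Prod>v\<in>J. pvar v) * idem I) = (if J = J' then 1 else (0 :: 'a::field))"
proof -
  have "I \<inter> J' = {}" "J \<inter> I = {}" "finite J"
    using assms idx_jdx_disjoint finite_R by (auto simp: jdx_iff intro: finite_subset)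
  then have "jet I J' ((\<Prod>v\<in>J. pvar v) * 1) = (if J \<subseteq> J' then jet I (J' - J) 1 else (0 :: 'a))"
    by (rule jet_prod_pvar_disjoint)
  moreover have "J \<subseteq> J' \<and> J' - J = {} \<longleftrightarrow> J = J'"
    by blast
  ultimately have "jet I J' (\<Prod>v\<in>J. pvar v) = (if J = J' then 1 else (0 :: 'a))"
    by auto
  then show ?thesis
    using assms by (simp add: jet_mult_idem)
qed

section \<open>Multiplication by a variable modulo the ideal\<close>

lemma pvar_mult_idem_in:
  assumes "I \<in> idx" "v \<in> I"
  shows "pvar v * idem I \<sim>\<^sub>H (idem I :: ('v, 'a::field) poly_in)"
proof -
  have I: "I \<subseteq> verts G" "v \<in> verts G - R"
    using assms by (auto simp: idx_iff)
  obtain q :: "('v, 'a) poly_in" where "q \<in> polys" "idem I = pvar v * q"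
    using idem_factor_in[OF I(1) assms(2)] by metis
  then show ?thesis
    using pvar_idem[OF I(2)] by simp
qed

text \<open>The factor \<open>1 - x_v\<close> of \<open>idem I\<close> meets \<open>x_v\<close>, and
  \<open>x_v (1 - x_v)\<close> is congruent to zero for \<open>v\<close> outside
  \<open>R\<close>.\<close>

lemma pvar_mult_idem_out:
  assumes "I \<in> idx" "v \<in> verts G - R - I"
  shows "pvar v * idem I \<sim>\<^sub>H (0 :: ('v, 'a::field) poly_in)"
proof -
  have I: "I \<subseteq> verts G" "v \<in> verts G - R"
    using assms by (auto simp: idx_iff)
  obtain q :: "('v, 'a) poly_in" where q: "q \<in> polys" "idem I = (1 - pvar v) * q"
    using idem_factor_out[OF I(1) assms(2)] by metis
  have "pvar v * q \<sim>\<^sub>H pvar v * (pvar v * q)"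
    using pvar_idem[OF I(2) q(1)] by (rule heq_sym)
  from heq_add[OF this, of "- (pvar v * (pvar v * q))" "- (pvar v * (pvar v * q))"] show ?thesis
    by (simp add: q algebra_simps)
qed

lemma pvar_mult_idem_neighbour:
  assumes "I \<in> idx" "u \<in> I" "dominates G u v"
  shows "pvar v * idem I \<sim>\<^sub>H (0 :: ('v, 'a::field) poly_in)"
proof -
  have I: "I \<subseteq> verts G"
    using assms by (auto simp: idx_iff)
  obtain q :: "('v, 'a) poly_in" where q: "q \<in> polys" "idem I = pvar u * q"
    using idem_factor_in[OF I assms(2)] by metis
  show ?thesis
    using pvar_edge[OF dominates_sym[OF assms(3)] q(1)] by (simp add: q)
qed

text \<open>Together with \<open>x_v\<close>, a suitable factor \<open>x_u\<close> of the product
  forms the square of a variable in \<open>R\<close> or the monomial of an edge.\<close>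

lemma pvar_mult_prod_pvar:
  fixes q :: "('v, 'a::field) poly_in"
  assumes J: "J \<in> jdx I" and v: "v \<in> J \<or> (\<exists>u\<in>J. dominates G u v \<or> dominates G v u)" and q: "q \<in> polys"
  shows "pvar v * ((\<Prod>u\<in>J. pvar u) * q) \<sim>\<^sub>H 0"
proof -
  obtain u where u: "u \<in> J" "u = v \<or> dominates G v u"
    using v dominates_sym by blast
  have "finite J" "J \<subseteq> R" "u \<in> R"
    using J u finite_R by (auto simp: jdx_iff intro: finite_subset)
  define r where "r = (\<Prod>u\<in>J - {u}. pvar u) * q"
  have r: "r \<in> polys"
    unfolding r_def using \<open>J \<subseteq> R\<close> R_subset q by (intro polynomial_algebra_closed(6) prod_pvar_polys) auto
  have eq: "(\<Prod>u\<in>J. pvar u) * q = pvar u * r"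
    unfolding r_def using prod.remove[OF \<open>finite J\<close> u(1), of "pvar :: 'v \<Rightarrow> ('v, 'a) poly_in"] by (simp add: mult.assoc)
  from u(2) show ?thesis
  proof
    assume "u = v"
    then show ?thesis
      using pvar_square[OF \<open>u \<in> R\<close> r] by (simp add: eq)
  next
    assume "dominates G v u"
    then show ?thesis
      using pvar_edge[OF _ r] by (simp add: eq)
  qed
qed

lemma idem_nonindependent:
  assumes "I \<subseteq> verts G - R" "I \<notin> idx"
  shows "idem I \<sim>\<^sub>H (0 :: ('v, 'a::field) poly_in)"
proof -
  obtain u v where uv: "u \<in> I" "v \<in> I" "dominates G u v"
    using assms by (auto simp: idx_iff)
  have "u \<noteq> v"
    using uv(3) no_loops by (auto simp: arcs_ends_conv)
  define q :: "('v, 'a) poly_in" where "q = (\<Prod>w\<in>I - {u} - {v}. pvar w) * (\<Prod>w\<in>verts G - R - I. 1 - pvar w)"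
  have "finite I"
    using assms finite_verts finite_subset by blast
  have "(\<Prod>w\<in>I. pvar w) = (pvar u :: ('v, 'a) poly_in) * (\<Prod>w\<in>I - {u}. pvar w)"
    using uv \<open>finite I\<close> by (intro prod.remove) auto
  also have "(\<Prod>w\<in>I - {u}. pvar w) = pvar v * (\<Prod>w\<in>I - {u} - {v}. pvar w)"
    using uv \<open>finite I\<close> \<open>u \<noteq> v\<close> by (intro prod.remove) auto
  finally have "idem I = pvar u * (pvar v * q)"
    by (simp add: idem_def q_def mult_ac)
  moreover have "q \<in> polys"
    unfolding q_def using assms
    by (intro polynomial_algebra_closed(6) prod_pvar_polys prod_one_minus_polys) auto
  ultimately show ?thesis
    using pvar_edge[OF uv(3)] by simp
qed

text \<open>Expanding the product of \<open>x_v + (1 - x_v) = 1\<close> over the vertices outside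
  \<open>R\<close> gives one \<open>idem I\<close> for each subset \<open>I\<close>; those of
  dependent sets are congruent to zero.\<close>

lemma sum_idem: "(\<Sum>I\<in>idx. idem I) \<sim>\<^sub>H 1"
proof -
  let ?W = "verts G - R"
  have "(1::('v, 'a::field) poly_in) = (\<Prod>v\<in>?W. pvar v + (1 - pvar v))"
    by simp
  also have "\<dots> = (\<Sum>I\<in>Pow ?W. idem I)"
    unfolding idem_def by (rule prod_add) simp
  finally have one: "(\<Sum>I\<in>Pow ?W. idem I) = (1::('v, 'a::field) poly_in)" ..
  have "(\<Sum>I\<in>idx. idem I) = (\<Sum>I\<in>Pow ?W. if I \<in> idx then idem I else 0 :: ('v, 'a) poly_in)"
    by (rule sum.mono_neutral_cong_left) (auto simp: idx_iff)
  also have "\<dots> \<sim>\<^sub>H (\<Sum>I\<in>Pow ?W. idem I)"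
    by (rule heq_sum) (auto intro: heq_sym idem_nonindependent)
  finally show ?thesis
    by (simp only: one)
qed

section \<open>Jets as coordinates modulo the ideal\<close>

text \<open>Induction on \<open>p\<close>. In the step for a variable, \<open>x_v\<close> acts on
  the \<open>X_J e_I\<close> by the transpose of its action on jets: as the identity if
  \<open>v \<in> I\<close>; otherwise it adds \<open>v\<close> to \<open>J\<close> when this yields
  a new member of \<open>jdx I\<close>, and gives zero when it does not.\<close>

lemma mult_idem_expand:
  fixes p :: "('v, 'a::field) poly_in"
  assumes p: "p \<in> polys" and I: "I \<in> idx"
  shows "p * idem I \<sim>\<^sub>H (\<Sum>J\<in>jdx I. pconst (jet I J p) * ((\<Prod>v\<in>J. pvar v) * idem I))"
  using p
proof (induction p rule: polynomial_algebra_induct)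
  case (const c)
  have "(\<Sum>J\<in>jdx I. pconst (jet I J (pconst c)) * ((\<Prod>v\<in>J. pvar v) * idem I)) =
      (\<Sum>J\<in>jdx I. if J = {} then pconst c * idem I else 0 :: ('v, 'a) poly_in)"
    by (intro sum.cong) auto
  also have "\<dots> = pconst c * idem I"
    using finite_jdx empty_jdx by (subst sum.delta) auto
  finally show ?case
    by simp
next
  case (add p q)
  have "pconst (c + d) = pconst c + (pconst d :: ('v, 'a) poly_in)" for c d
    by (simp add: pconst_def single_add)
  then show ?case
    using heq_add[OF add.IH] by (simp add: distrib_right sum.distrib)
next
  case (var v p)
  define T :: "'v set \<Rightarrow> ('v, 'a) poly_in" where "T J = (\<Prod>v\<in>J. pvar v) * idem I" for J
  have idem: "idem I \<in> (polys :: ('v, 'a) poly_in set)"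
    using I by (intro idem_polys) (auto simp: idx_iff)
  have T: "T J \<in> polys" if "J \<in> jdx I" for J
    unfolding T_def using that R_subset idem
    by (intro polynomial_algebra_closed(6) prod_pvar_polys) (auto simp: jdx_iff)
  have disj: "I \<inter> J = {}" if "J \<in> jdx I" for J
    using idx_jdx_disjoint I that by blast
  have prod: "(\<Prod>v\<in>J. pvar v) \<in> (polys :: ('v, 'a) poly_in set)" if "J \<in> jdx I" for J
    using that R_subset by (intro prod_pvar_polys) (auto simp: jdx_iff)
  have "pvar v * p * idem I \<sim>\<^sub>H pvar v * (\<Sum>J\<in>jdx I. pconst (jet I J p) * T J)"
    using heq_mult[OF _ var.IH, of "pvar v"] var.hyps by (simp add: mult.assoc T_def)
  also have "\<dots> = (\<Sum>J\<in>jdx I. pconst (jet I J p) * (pvar v * T J))"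
    by (simp add: sum_distrib_left mult_ac)
  also have "\<dots> \<sim>\<^sub>H (\<Sum>J\<in>jdx I. pconst (jet I J (pvar v * p)) * T J)"
  proof (cases "v \<in> I")
    case True
    have "pvar v * T J \<sim>\<^sub>H T J" if "J \<in> jdx I" for J
      using heq_mult[OF prod[OF that] pvar_mult_idem_in[OF I True]] by (simp add: T_def mult_ac)
    then show ?thesis
      using disj True by (intro heq_sum) (simp add: jet_pvar_mult heq_mult)
  next
    case False
    \<comment> \<open>The sets to which \<open>v\<close> can be added; inserting and deleting
      \<open>v\<close> matches them with \<open>?C\<close>, the sets that contain
      \<open>v\<close>.\<close>
    define B where "B = {J \<in> jdx I. v \<notin> J \<and> insert v J \<in> jdx I}"
    let ?C = "{J \<in> jdx I. v \<in> J}"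
    have step: "pvar v * T J \<sim>\<^sub>H (if J \<in> B then T (insert v J) else 0)" if J: "J \<in> jdx I" for J
    proof -
      have loop: "\<not> dominates G v v"
        using no_loops by (auto simp: arcs_ends_conv)
      \<comment> \<open>Obstructions to adding \<open>v\<close>: it lies in \<open>J\<close> or is
        adjacent to \<open>J\<close>, it is outside \<open>R\<close>, or it is adjacent to
        \<open>I\<close>. Each corresponds to one of the vanishing lemmas above.\<close>
      consider "J \<in> B" | "v \<in> J \<or> (\<exists>u\<in>J. dominates G u v \<or> dominates G v u)" "J \<notin> B"
        | "v \<notin> R" "J \<notin> B" | u where "u \<in> I" "dominates G u v" "J \<notin> B"
      proof (cases "J \<in> B")
        case notB: False
        then have "v \<in> J \<or> insert v J \<notin> jdx I"
          using J by (simp add: B_def)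
        then have "v \<in> J \<or> (\<exists>u\<in>J. dominates G u v \<or> dominates G v u) \<or> v \<notin> R \<or> (\<exists>u\<in>I. dominates G u v)"
          using J loop unfolding jdx_iff ball_simps insert_subset by blast
        then show ?thesis
          using that notB by blast
      qed
      then show ?thesis
      proof cases
        case 1
        then have "finite J" "v \<notin> J"
          using finite_R by (auto simp: B_def jdx_iff intro: finite_subset)
        then have "pvar v * T J = T (insert v J)"
          by (simp add: T_def mult.assoc)
        then show ?thesis
          using 1 by simp
      next
        case 2
        then show ?thesis
          using pvar_mult_prod_pvar[OF J 2(1) idem] 2(2) by (simp add: T_def)
      next
        case 3
        then have "pvar v * idem I \<sim>\<^sub>H (0 :: ('v, 'a) poly_in)"
          using pvar_mult_idem_out[OF I] False var.hyps by blast
        then have "pvar v * T J \<sim>\<^sub>H 0"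
          unfolding T_def using heq_mult[OF prod[OF J], of "pvar v * idem I" 0] by (simp add: mult_ac)
        then show ?thesis
          using 3 by simp
      next
        case 4
        then have "pvar v * idem I \<sim>\<^sub>H (0 :: ('v, 'a) poly_in)"
          using pvar_mult_idem_neighbour[OF I] by blast
        then have "pvar v * T J \<sim>\<^sub>H 0"
          unfolding T_def using heq_mult[OF prod[OF J], of "pvar v * idem I" 0] by (simp add: mult_ac)
        then show ?thesis
          using 4 by simp
      qed
    qed
    have "(\<Sum>J\<in>jdx I. pconst (jet I J p) * (pvar v * T J)) \<sim>\<^sub>H
        (\<Sum>J\<in>jdx I. pconst (jet I J p) * (if J \<in> B then T (insert v J) else 0))"
      using step by (intro heq_sum heq_mult) auto
    also have "\<dots> = (\<Sum>J\<in>B. pconst (jet I J p) * T (insert v J))"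
      by (rule sum.mono_neutral_cong_right) (auto simp: finite_jdx B_def)
    \<comment> \<open>After reindexing, \<open>X_J e_I\<close> carries the jet at
      \<open>J - {v}\<close>, which is the jet of \<open>x_v p\<close> at \<open>J\<close>.\<close>
    also have "\<dots> = (\<Sum>J\<in>?C. pconst (jet I (J - {v}) p) * T J)"
      by (rule sum.reindex_bij_witness[where i = "\<lambda>J. J - {v}" and j = "insert v"])
        (auto simp: B_def insert_absorb intro: jdx_subset)
    also have "\<dots> = (\<Sum>J\<in>jdx I. pconst (jet I J (pvar v * p)) * T J)"
      using disj False
      by (intro sum.mono_neutral_cong_left) (auto simp: finite_jdx jet_pvar_mult)
    finally show ?thesis .
  qed
  finally show ?case
    by (simp only: T_def)
qed

lemma mult_sum_idem:
  assumes "p \<in> polys"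
  shows "(\<Sum>I\<in>idx. p * idem I) \<sim>\<^sub>H p"
  using heq_mult[OF assms sum_idem] by (simp add: sum_distrib_left)

text \<open>The jets vanish on the ideal, which is one direction. Conversely they determine each
  \<open>p * idem I\<close> up to congruence, and these add up to \<open>p\<close>.\<close>

lemma heq_iff_jets:
  fixes p q :: "('v, 'a::field) poly_in"
  assumes "p \<in> polys" "q \<in> polys"
  shows "p \<sim>\<^sub>H q \<longleftrightarrow> (\<forall>I\<in>idx. \<forall>J\<in>jdx I. jet I J p = jet I J q)"
proof
  assume "p \<sim>\<^sub>H q"
  then show "\<forall>I\<in>idx. \<forall>J\<in>jdx I. jet I J p = jet I J q"
    using jet_H_ideal[of "p - q"] by (simp add: heq_def)
next
  assume jets: "\<forall>I\<in>idx. \<forall>J\<in>jdx I. jet I J p = jet I J q"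
  have "p * idem I \<sim>\<^sub>H q * idem I" if I: "I \<in> idx" for I
  proof -
    have "p * idem I \<sim>\<^sub>H (\<Sum>J\<in>jdx I. pconst (jet I J p) * ((\<Prod>v\<in>J. pvar v) * idem I))"
      by (rule mult_idem_expand[OF assms(1) I])
    also have "\<dots> = (\<Sum>J\<in>jdx I. pconst (jet I J q) * ((\<Prod>v\<in>J. pvar v) * idem I))"
      using jets I by simp
    also have "\<dots> \<sim>\<^sub>H q * idem I"
      by (rule heq_sym[OF mult_idem_expand[OF assms(2) I]])
    finally show ?thesis .
  qed
  then have "(\<Sum>I\<in>idx. p * idem I) \<sim>\<^sub>H (\<Sum>I\<in>idx. q * idem I)"
    by (rule heq_sum)
  from heq_trans[OF heq_trans[OF heq_sym[OF mult_sum_idem[OF assms(1)]] this] mult_sum_idem[OF assms(2)]]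
  show "p \<sim>\<^sub>H q" .
qed

end

section \<open>The decomposition of the algebra\<close>

context graph_with_squares
begin

section \<open>The quotient map on polynomials\<close>

interpretation Poly: cring "polynomial_algebra (verts G) :: ('v, 'a::field) poly_in ring"
  by (rule cring_polynomial_algebra)

interpretation HI: ideal "H_ideal G R :: ('v, 'a::field) poly_in set" "polynomial_algebra (verts G)"
  by (rule ideal_H_ideal)

abbreviation H :: "('v, 'a::field) poly_in set ring" where "H \<equiv> H_alg G R"
abbreviation h :: "('v, 'a::field) poly_in \<Rightarrow> ('v, 'a) poly_in set" where "h \<equiv> H_class G R"

lemma cring_H: "cring (H :: ('v, 'a::field) poly_in set ring)"
  unfolding H_alg_def by (rule HI.quotient_is_cring) (rule Poly.is_cring)

lemma H_class_hom:
  "ring_hom_cring (polynomial_algebra (verts G)) H (h :: ('v, 'a::field) poly_in \<Rightarrow> _)"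
  unfolding H_alg_def H_class_def[abs_def] by (rule HI.rcos_ring_hom_cring) (rule Poly.is_cring)

lemma H_carrier: "carrier H = h ` (polys :: ('v, 'a::field) poly_in set)"
proof -
  have "carrier H = a_rcosets\<^bsub>polynomial_algebra (verts G)\<^esub> (H_ideal G R :: ('v, 'a) poly_in set)"
    by (simp add: H_alg_def FactRing_def)
  also have "\<dots> = h ` polys"
    unfolding A_RCOSETS_def' H_class_def[abs_def] a_r_coset_def' by (rule UNION_singleton_eq_range)
  finally show ?thesis .
qed

lemma h_zero: "\<zero>\<^bsub>H\<^esub> = h (0 :: ('v, 'a::field) poly_in)"
  unfolding ring_hom_cring.hom_zero[OF H_class_hom, symmetric] by simp

lemma h_one: "\<one>\<^bsub>H\<^esub> = h (1 :: ('v, 'a::field) poly_in)"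
  by (simp add: H_alg_def FactRing_def H_class_def)

lemma
  fixes p q :: "('v, 'a::field) poly_in"
  assumes "p \<in> polys" "q \<in> polys"
  shows h_add: "h p \<oplus>\<^bsub>H\<^esub> h q = h (p + q)"
    and h_mult: "h p \<otimes>\<^bsub>H\<^esub> h q = h (p * q)"
    and h_minus: "h p \<ominus>\<^bsub>H\<^esub> h q = h (p - q)"
proof -
  interpret h: ring_hom_cring "polynomial_algebra (verts G)" H "h :: ('v, 'a) poly_in \<Rightarrow> _"
    by (rule H_class_hom)
  show add: "h p \<oplus>\<^bsub>H\<^esub> h q = h (p + q)" "h p \<otimes>\<^bsub>H\<^esub> h q = h (p * q)"
    using assms h.hom_add[of p q] h.hom_mult[of p q] by simp_all
  show "h p \<ominus>\<^bsub>H\<^esub> h q = h (p - q)"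
    using assms h.hom_add[of p "- q"] h.hom_a_inv[of q] by (simp add: a_minus_def polynomial_algebra_a_inv)
qed

lemma h_eq_iff:
  fixes p q :: "('v, 'a::field) poly_in"
  assumes "p \<in> polys" "q \<in> polys"
  shows "h p = h q \<longleftrightarrow> p \<sim>\<^sub>H q"
  unfolding heq_def H_class_def
  using Poly.quotient_eq_iff_same_a_r_cos[OF ideal_H_ideal assms] assms
  by (simp add: polynomial_algebra_minus)

lemma h_eq_iff_jets:
  assumes "p \<in> polys" "q \<in> polys"
  shows "h p = h q \<longleftrightarrow> (\<forall>I\<in>idx. \<forall>J\<in>jdx I. jet I J p = jet I J q)"
  using assms by (simp add: h_eq_iff heq_iff_jets)

lemma h_finprod:
  fixes f :: "'i \<Rightarrow> ('v, 'a::field) poly_in"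
  assumes "f \<in> S \<rightarrow> polys"
  shows "(\<Otimes>\<^bsub>H\<^esub>i\<in>S. h (f i)) = h (prod f S)"
proof -
  have "(\<Otimes>\<^bsub>polynomial_algebra (verts G)\<^esub>i\<in>S. f i) = prod f S"
    using assms by (induction S rule: infinite_finite_induct) (auto simp: Pi_iff)
  then show ?thesis
    using ring_hom_cring.hom_finprod[OF H_class_hom assms] by (simp add: comp_def)
qed

lemma H_X_eq:
  assumes "U \<subseteq> verts G"
  shows "H_X G R U = h (\<Prod>u\<in>U. pvar u)"
  unfolding H_X_def H_x_def using assms by (intro h_finprod) auto

lemma H_X_minus_eq:
  assumes "U \<subseteq> verts G"
  shows "H_X_minus G R U = h (\<Prod>u\<in>U. 1 - pvar u :: ('v, 'a::field) poly_in)"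
proof -
  interpret H: cring "H :: ('v, 'a) poly_in set ring"
    by (rule cring_H)
  have "H_X_minus G R U = (\<Otimes>\<^bsub>H\<^esub>u\<in>U. h (1 - pvar u :: ('v, 'a) poly_in))"
    unfolding H_X_minus_def H_x_minus_def H_x_def h_one using assms
    by (intro H.finprod_cong') (auto simp: h_minus H_carrier)
  also have "\<dots> = h (\<Prod>u\<in>U. 1 - pvar u :: ('v, 'a) poly_in)"
    using assms by (intro h_finprod) auto
  finally show ?thesis .
qed

text \<open>Identifies the basis vectors of the theorem with classes of \<open>X_J e_I\<close>; as
  \<open>I\<close> and \<open>J\<close> are disjoint, the product over their union splits.\<close>

lemma H_X_H_X_minus:
  assumes "I \<in> idx" "J \<in> jdx I"
  shows "H_X G R (I \<union> J) \<otimes>\<^bsub>H\<^esub> H_X_minus G R (verts G - R - I) =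
    h ((\<Prod>v\<in>J. pvar v) * idem I :: ('v, 'a::field) poly_in)"
proof -
  have sub: "I \<union> J \<subseteq> verts G" "I \<inter> J = {}" "finite I" "finite J"
    using assms R_subset idx_jdx_disjoint finite_R finite_subset[OF _ finite_verts]
    by (auto simp: idx_iff jdx_iff intro: finite_subset)
  have "(\<Prod>v\<in>I \<union> J. pvar v) = (\<Prod>v\<in>I. pvar v) * (\<Prod>v\<in>J. pvar v :: ('v, 'a) poly_in)"
    by (rule prod.union_disjoint) (use sub in auto)
  moreover have "H_X G R (I \<union> J) \<otimes>\<^bsub>H\<^esub> H_X_minus G R (verts G - R - I) =
      h ((\<Prod>v\<in>I \<union> J. pvar v) * (\<Prod>v\<in>verts G - R - I. 1 - pvar v) :: ('v, 'a) poly_in)"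
    using sub by (simp add: H_X_eq H_X_minus_eq h_mult prod_pvar_polys prod_one_minus_polys Diff_subset_conv
        subset_iff)
  ultimately show ?thesis
    by (simp add: idem_def mult_ac)
qed

section \<open>The summands as principal ideals\<close>

lemma idem_in_polys: "I \<in> idx \<Longrightarrow> idem I \<in> polys"
  by (rule idem_polys) (auto simp: idx_iff)

lemma P_set_eq:
  assumes "I \<in> idx"
  shows "P_set G R I = {h (p * idem I) | p :: ('v, 'a::field) poly_in. p \<in> polys}"
proof -
  have "H_X G R I \<otimes>\<^bsub>H\<^esub> H_X_minus G R (verts G - R - I) = h (idem I :: ('v, 'a) poly_in)"
    using H_X_H_X_minus[OF assms empty_jdx, where 'a = 'a] by simp
  then have "P_set G R I = (\<lambda>x. x \<otimes>\<^bsub>H\<^esub> h (idem I)) ` h ` (polys :: ('v, 'a) poly_in set)"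
    by (auto simp: P_set_def cgenideal_def H_carrier)
  also have "\<dots> = (\<lambda>p. h (p * idem I)) ` polys"
    unfolding image_image by (intro image_cong refl h_mult idem_in_polys assms)
  finally show ?thesis
    by blast
qed

text \<open>Both sides have the same jets, because projecting to the index \<open>I\<close> twice is
  the same as doing it once.\<close>

lemma idem_mult_idem:
  fixes p :: "('v, 'a::field) poly_in"
  assumes "I \<in> idx" "p \<in> polys"
  shows "p * idem I * idem I \<sim>\<^sub>H p * idem I"
  using assms by (simp add: idem_in_polys heq_iff_jets jet_mult_idem)

text \<open>Multiples of an idempotent are exactly the elements it fixes.\<close>

lemma h_in_P_set_iff:
  fixes p :: "('v, 'a::field) poly_in"
  assumes "I \<in> idx" "p \<in> polys"
  shows "h p \<in> P_set G R I \<longleftrightarrow> p * idem I \<sim>\<^sub>H p"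
proof
  assume "h p \<in> P_set G R I"
  then obtain q :: "('v, 'a) poly_in" where q: "q \<in> polys" "h p = h (q * idem I)"
    using assms by (auto simp: P_set_eq)
  then have "p \<sim>\<^sub>H q * idem I"
    using assms by (simp add: idem_in_polys h_eq_iff)
  then have "p * idem I \<sim>\<^sub>H q * idem I * idem I"
    using assms by (intro heq_mult_right) (simp_all add: idem_in_polys)
  also have "\<dots> \<sim>\<^sub>H q * idem I"
    using assms q by (intro idem_mult_idem)
  also have "\<dots> \<sim>\<^sub>H p"
    by (rule heq_sym) fact
  finally show "p * idem I \<sim>\<^sub>H p" .
next
  assume "p * idem I \<sim>\<^sub>H p"
  then have "h p = h (p * idem I)"
    using assms by (simp add: idem_in_polys h_eq_iff heq_sym)
  then show "h p \<in> P_set G R I"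
    using assms by (auto simp: P_set_eq)
qed

lemma P_setE:
  fixes x :: "('v, 'a::field) poly_in set"
  assumes "I \<in> idx" "x \<in> P_set G R I"
  obtains p where "p \<in> polys" "x = h p" "p * idem I \<sim>\<^sub>H p"
proof -
  obtain q :: "('v, 'a) poly_in" where "q \<in> polys" "x = h (q * idem I)"
    using assms by (auto simp: P_set_eq)
  then show ?thesis
    using that[of "q * idem I"] assms by (simp add: idem_in_polys idem_mult_idem)
qed

lemma jet_P_set:
  fixes p :: "('v, 'a::field) poly_in"
  assumes "I \<in> idx" "p \<in> polys" "p * idem I \<sim>\<^sub>H p" "I' \<in> idx" "I' \<noteq> I" "J \<in> jdx I'"
  shows "jet I' J p = 0"
proof -
  have "jet I' J (p * idem I) = jet I' J p"
    using assms by (simp add: idem_in_polys heq_iff_jets)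
  then show ?thesis
    using assms by (simp add: jet_mult_idem)
qed

lemma module_H: "module H (H_module G R :: (('v, 'a::field) poly_in set, ('v, 'a) poly_in set) module)"
  unfolding H_module_def by (rule module_regular_module) (rule cring_H)

lemma submodule_P_set:
  assumes "I \<in> idx"
  shows "submodule (P_set G R I) (H :: ('v, 'a::field) poly_in set ring) (H_module G R)"
proof -
  have "H_X G R I \<otimes>\<^bsub>H\<^esub> H_X_minus G R (verts G - R - I) = h (idem I :: ('v, 'a) poly_in)"
    using H_X_H_X_minus[OF assms empty_jdx, where 'a = 'a] by simp
  then have "ideal (P_set G R I) (H :: ('v, 'a) poly_in set ring)"
    unfolding P_set_def
    by (intro cring.cgenideal_ideal[OF cring_H]) (simp add: H_carrier idem_in_polys assms)
  then show ?thesis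
    unfolding H_module_def by (rule submodule_regular_moduleI[OF cring_H])
qed

text \<open>Kept general in the record \<open>M\<close>, as such sums occur in the regular module of
  \<open>H\<close> as well as in the vector space underlying a summand.\<close>

lemma h_finsum:
  fixes M :: "(('v, 'a::field) poly_in set, 'm) ring_scheme"
  assumes "abelian_monoid M" "ring.add M = ring.add H" "\<zero>\<^bsub>M\<^esub> = h 0"
    and "finite S" "\<And>i. i \<in> S \<Longrightarrow> f i \<in> polys" "\<And>i. i \<in> S \<Longrightarrow> h (f i) \<in> carrier M"
  shows "(\<Oplus>\<^bsub>M\<^esub>i\<in>S. h (f i)) = h (sum f S)"
proof -
  interpret M: abelian_monoid M by fact
  show ?thesis
    using assms(4-6)
  proof (induction S)
    case (insert i S)
    have "(\<Oplus>\<^bsub>M\<^esub>i\<in>insert i S. h (f i)) = h (f i) \<oplus>\<^bsub>M\<^esub> (\<Oplus>\<^bsub>M\<^esub>i\<in>S. h (f i))"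
      using insert by (intro M.finsum_insert) auto
    also have "\<dots> = h (f i + sum f S)"
      using insert polynomial_algebra_sum_closed[of S f] by (simp add: assms(2) h_add)
    finally show ?case
      using insert by simp
  qed (simp add: assms(3))
qed

lemma H_module_simps [simp]:
  "carrier (H_module G R) = carrier H" "ring.zero (H_module G R) = \<zero>\<^bsub>H\<^esub>"
  "ring.add (H_module G R) = ring.add H" "module.smult (H_module G R) = monoid.mult H"
  by (simp_all add: H_module_def)

text \<open>Existence holds because the idempotents add up to 1. For uniqueness, the jets of the
  component at \<open>I\<close> are compared with those of \<open>p * idem I\<close>.\<close>

lemma direct_sum_P_set:
  "is_direct_sum H (H_module G R :: (('v, 'a::field) poly_in set, ('v, 'a) poly_in set) module) idx (P_set G R)"
  unfolding is_direct_sum_def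
proof (intro conjI ballI)
  let ?M = "H_module G R :: (('v, 'a) poly_in set, ('v, 'a) poly_in set) module"
  interpret M: module H ?M by (rule module_H)
  fix m
  assume "m \<in> carrier ?M"
  then obtain p :: "('v, 'a) poly_in" where p: "p \<in> polys" "m = h p"
    by (auto simp: H_carrier)
  have sum: "(\<Oplus>\<^bsub>?M\<^esub>I\<in>idx. h (q I)) = h (sum q idx)" if "\<And>I. I \<in> idx \<Longrightarrow> q I \<in> polys" for q
    using that finite_idx by (intro h_finsum M.abelian_monoid_axioms) (auto simp: h_zero H_carrier)
  show "\<exists>!f. f \<in> (\<Pi>\<^sub>E I\<in>idx. P_set G R I) \<and> m = (\<Oplus>\<^bsub>?M\<^esub>I\<in>idx. f I)"
  \<comment> \<open>The components are the multiples of \<open>p\<close> by the idempotents, made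
    extensional outside \<open>idx\<close>.\<close>
  proof (rule ex1I[of _ "\<lambda>I\<in>idx. h (p * idem I)"], intro conjI)
    show "(\<lambda>I\<in>idx. h (p * idem I)) \<in> (\<Pi>\<^sub>E I\<in>idx. P_set G R I)"
      using p by (auto simp: P_set_eq)
    have "(\<Oplus>\<^bsub>?M\<^esub>I\<in>idx. (\<lambda>I\<in>idx. h (p * idem I)) I) = (\<Oplus>\<^bsub>?M\<^esub>I\<in>idx. h (p * idem I))"
      using p by (intro M.finsum_cong') (auto simp: H_carrier idem_in_polys)
    also have "\<dots> = h (\<Sum>I\<in>idx. p * idem I)"
      using p by (intro sum) (simp add: idem_in_polys)
    also have "\<dots> = h p"
      using p by (subst h_eq_iff) (auto intro: mult_sum_idem simp: idem_in_polys)
    finally show "m = (\<Oplus>\<^bsub>?M\<^esub>I\<in>idx. (\<lambda>I\<in>idx. h (p * idem I)) I)"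
      using p by simp
  next
    fix f
    assume f: "f \<in> (\<Pi>\<^sub>E I\<in>idx. P_set G R I) \<and> m = (\<Oplus>\<^bsub>?M\<^esub>I\<in>idx. f I)"
    then have "\<forall>I\<in>idx. \<exists>q. q \<in> polys \<and> f I = h q \<and> q * idem I \<sim>\<^sub>H q"
      by (metis P_setE PiE_mem)
    then obtain q :: "'v set \<Rightarrow> ('v, 'a) poly_in" where q: "\<And>I. I \<in> idx \<Longrightarrow> q I \<in> polys" "\<And>I. I \<in> idx \<Longrightarrow> f I = h (q I)"
        "\<And>I. I \<in> idx \<Longrightarrow> q I * idem I \<sim>\<^sub>H q I"
      by metis
    have "m = (\<Oplus>\<^bsub>?M\<^esub>I\<in>idx. h (q I))"
      using q f M.finsum_cong'[of idx idx "\<lambda>I. h (q I)" f] by (simp add: H_carrier Pi_iff)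
    then have "h p = h (sum q idx)"
      using p sum q by simp
    then have jets: "jet I J p = (\<Sum>I'\<in>idx. jet I J (q I'))" if "I \<in> idx" "J \<in> jdx I" for I J
      using that p q(1) polynomial_algebra_sum_closed[of idx q] by (simp add: h_eq_iff_jets jet_sum)
    have "f I = h (p * idem I)" if I: "I \<in> idx" for I
    proof -
      \<comment> \<open>At \<open>I' = I\<close> the other components contribute nothing to the jets
        of \<open>p\<close>; at any other \<open>I'\<close> both sides vanish.\<close>
      have "jet I' J (q I) = jet I' J (p * idem I)" if I': "I' \<in> idx" "J \<in> jdx I'" for I' J
      proof (cases "I' = I")
        case True
        have "jet I J p = (\<Sum>I''\<in>idx. if I'' = I then jet I J (q I) else 0)"
          using jets[of I J] I I' True q jet_P_set[of _ "q _" I J] by (auto intro!: sum.cong)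
        then show ?thesis
          using True I I' finite_idx by (simp add: jet_mult_idem)
      next
        case False
        then show ?thesis
          using I I' q jet_P_set[of I "q I" I' J] by (simp add: jet_mult_idem)
      qed
      then show ?thesis
        using p q I by (simp add: h_eq_iff_jets idem_in_polys)
    qed
    then show "f = (\<lambda>I\<in>idx. h (p * idem I))"
      using f by (intro PiE_ext[of f idx]) auto
  qed
qed (auto simp: module_H finite_idx submodule_P_set)

end

section \<open>The summands and their tops\<close>

context graph_with_squares
begin

section \<open>Scalars and the vector space of a summand\<close>

abbreviation F :: "'a::field ring" where "F \<equiv> ring_of_type_algebra"

lemma h_in_carrier: "p \<in> polys \<Longrightarrow> h p \<in> carrier H"
  by (simp add: H_carrier)

lemma structure_map_hom: "ring_hom_cring F H (\<lambda>c. h (pconst c :: ('v, 'a::field) poly_in))"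
proof (intro ring_hom_cring.intro ring_hom_cring_axioms.intro)
  show "cring (F :: 'a ring)"
    by (rule cring_from_type_algebra)
  show "cring (H :: ('v, 'a) poly_in set ring)"
    by (rule cring_H)
  show "(\<lambda>c. h (pconst c :: ('v, 'a) poly_in)) \<in> ring_hom F H"
    by (rule ring_hom_memI) (simp_all add: h_in_carrier h_add h_mult h_one pconst_simps)
qed

lemma P_module_simps [simp]:
  "carrier (P_module G R I) = P_set G R I" "ring.zero (P_module G R I) = \<zero>\<^bsub>H\<^esub>"
  "ring.add (P_module G R I) = ring.add H" "module.smult (P_module G R I) = monoid.mult H"
  by (simp_all add: P_module_def)

context
  fixes I :: "'v set"
  assumes I: "I \<in> idx"
begin

abbreviation P :: "(('v, 'a::field) poly_in set, ('v, 'a) poly_in set) module" where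
  "P \<equiv> P_module G R I"

abbreviation T :: "'v set \<Rightarrow> ('v, 'a::field) poly_in" where
  "T J \<equiv> (\<Prod>v\<in>J. pvar v) * idem I"

lemma T_polys: "J \<in> jdx I \<Longrightarrow> T J \<in> polys"
  using I R_subset
  by (intro polynomial_algebra_closed(6) prod_pvar_polys idem_in_polys) (auto simp: jdx_iff)

lemma module_P: "module H (P :: (('v, 'a::field) poly_in set, ('v, 'a) poly_in set) module)"
  unfolding P_module_def by (rule submodule.submodule_is_module[OF submodule_P_set[OF I] module_H])

lemma module_P_vector_space:
  "module F (as_vector_space G R (P :: (('v, 'a::field) poly_in set, ('v, 'a) poly_in set) module))"
  unfolding as_vector_space_def by (rule module_restrict_scalars[OF structure_map_hom module_P])

lemma h_mult_idem_in_P_set: "p \<in> polys \<Longrightarrow> h (p * idem I) \<in> P_set G R I"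
  using I by (auto simp: P_set_eq)

lemma P_set_mult:
  assumes "h p \<in> P_set G R I" "p \<in> polys" "q \<in> polys"
  shows "h (q * p) \<in> P_set G R I"
  using submodule.smult_closed[OF submodule_P_set[OF I] h_in_carrier[OF assms(3)] assms(1)] assms
  by (simp add: h_mult)

lemma T_in_P_set: "J \<in> jdx I \<Longrightarrow> h (T J) \<in> P_set G R I"
  using R_subset by (intro h_mult_idem_in_P_set prod_pvar_polys) (auto simp: jdx_iff)

text \<open>Multiplication by \<open>idem I\<close> is the identity on the summand, so the expansion
  of \<open>p * idem I\<close> is one of \<open>p\<close> itself.\<close>

lemma P_expand:
  fixes p :: "('v, 'a::field) poly_in"
  assumes "h p \<in> P_set G R I" "p \<in> polys"
  shows "h p = h (\<Sum>J\<in>jdx I. pconst (jet I J p) * T J)"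
proof -
  have "p \<sim>\<^sub>H p * idem I"
    using assms I by (simp add: h_in_P_set_iff heq_sym)
  also have "\<dots> \<sim>\<^sub>H (\<Sum>J\<in>jdx I. pconst (jet I J p) * T J)"
    using assms I by (intro mult_idem_expand)
  finally show ?thesis
    using assms T_polys by (subst h_eq_iff) auto
qed

lemma jet_sum_T:
  fixes c :: "'v set \<Rightarrow> 'a::field"
  assumes "J \<in> jdx I"
  shows "jet I J (\<Sum>K\<in>jdx I. pconst (c K) * T K) = c J"
proof -
  have "jet I J (\<Sum>K\<in>jdx I. pconst (c K) * T K) = (\<Sum>K\<in>jdx I. if K = J then c K else 0)"
    using assms I unfolding jet_sum by (intro sum.cong) (simp_all add: jet_prod_pvar_mult_idem)
  then show ?thesis
    using assms finite_jdx by simp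
qed

lemma vector_space_simps [simp]:
  "carrier (as_vector_space G R M) = carrier M" "ring.zero (as_vector_space G R M) = \<zero>\<^bsub>M\<^esub>"
  "ring.add (as_vector_space G R M) = ring.add M"
  "module.smult (as_vector_space G R M) c m = h (pconst c) \<odot>\<^bsub>M\<^esub> m"
  by (simp_all add: as_vector_space_def)

lemma inj_on_T: "inj_on (\<lambda>J. h (T J :: ('v, 'a::field) poly_in)) (jdx I)"
proof (rule inj_onI)
  fix J K
  assume JK: "J \<in> jdx I" "K \<in> jdx I" and eq: "h (T J :: ('v, 'a) poly_in) = h (T K)"
  from eq have "jet I J (T J :: ('v, 'a) poly_in) = jet I J (T K)"
    using JK I by (simp add: h_eq_iff_jets T_polys)
  then show "J = K"
    using JK I by (simp add: jet_prod_pvar_mult_idem split: if_splits)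
qed

text \<open>The jets at \<open>I\<close> read off the coefficients of a combination, which gives
  independence, and they are the coefficients of a given element, which gives spanning.\<close>

lemma is_basis_P:
  "is_basis F (as_vector_space G R (P :: (('v, 'a::field) poly_in set, ('v, 'a) poly_in set) module))
     ((\<lambda>J. h (T J)) ` jdx I)"
proof (rule is_basis_imageI)
  let ?M = "as_vector_space G R (P :: (('v, 'a) poly_in set, ('v, 'a) poly_in set) module)"
  interpret M: module "F :: 'a ring" ?M
    by (rule module_P_vector_space)
  show "module (F :: 'a ring) ?M" ..
  show "finite (jdx I)"
    by (rule finite_jdx)
  show "inj_on (\<lambda>J. h (T J :: ('v, 'a) poly_in)) (jdx I)"
    by (rule inj_on_T)
  show "(\<lambda>J. h (T J)) \<in> jdx I \<rightarrow> carrier ?M"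
    by (auto intro: T_in_P_set)
  have sum: "(\<Oplus>\<^bsub>?M\<^esub>J\<in>jdx I. c J \<odot>\<^bsub>?M\<^esub> h (T J)) = h (\<Sum>J\<in>jdx I. pconst (c J) * T J)" for c
  proof -
    have "(\<Oplus>\<^bsub>?M\<^esub>J\<in>jdx I. c J \<odot>\<^bsub>?M\<^esub> h (T J)) = (\<Oplus>\<^bsub>?M\<^esub>J\<in>jdx I. h (pconst (c J) * T J))"
      by (intro M.finsum_cong') (auto simp: h_mult T_polys intro!: P_set_mult T_in_P_set)
    also have "\<dots> = h (\<Sum>J\<in>jdx I. pconst (c J) * T J)"
      using finite_jdx
      by (intro h_finsum M.abelian_monoid_axioms) (auto simp: h_zero T_polys intro!: P_set_mult T_in_P_set)
    finally show ?thesis .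
  qed
  show "\<forall>J\<in>jdx I. c J = \<zero>\<^bsub>F\<^esub>"
    if "(\<Oplus>\<^bsub>?M\<^esub>J\<in>jdx I. c J \<odot>\<^bsub>?M\<^esub> h (T J)) = \<zero>\<^bsub>?M\<^esub>" for c
  proof
    fix J
    assume J: "J \<in> jdx I"
    have "h (\<Sum>J\<in>jdx I. pconst (c J) * T J) = h (0 :: ('v, 'a) poly_in)"
      using that by (simp only: sum) (simp add: h_zero)
    moreover have "(\<Sum>J\<in>jdx I. pconst (c J) * T J) \<in> polys"
      by (intro polynomial_algebra_sum_closed) (simp add: T_polys)
    ultimately have "jet I J (\<Sum>J\<in>jdx I. pconst (c J) * T J) = 0"
      using J I by (simp add: h_eq_iff_jets)
    then show "c J = \<zero>\<^bsub>F\<^esub>"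
      using J by (simp add: jet_sum_T)
  qed
  show "\<exists>c\<in>jdx I \<rightarrow> carrier F. m = (\<Oplus>\<^bsub>?M\<^esub>J\<in>jdx I. c J \<odot>\<^bsub>?M\<^esub> h (T J))" if m: "m \<in> carrier ?M" for m
  proof -
    from m have "m \<in> P_set G R I"
      by simp
    then obtain p :: "('v, 'a) poly_in" where p: "p \<in> polys" "m = h p"
      using P_setE[OF I] by metis
    then have "m = (\<Oplus>\<^bsub>?M\<^esub>J\<in>jdx I. jet I J p \<odot>\<^bsub>?M\<^esub> h (T J))"
      using P_expand[of p] m unfolding sum by simp
    then show ?thesis
      by (intro bexI[of _ "\<lambda>J. jet I J p"]) auto
  qed
qed

section \<open>The greatest proper submodule of a summand\<close>

text \<open>The kernel of the jet at \<open>(I, {})\<close> on the summand, named in anticipation of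
  being the radical. It is stated through representatives; their choice is immaterial because jets
  vanish on the ideal.\<close>

definition rad_P :: "('v, 'a::field) poly_in set set" where
  "rad_P = {h p | p. p \<in> polys \<and> h p \<in> P_set G R I \<and> jet I {} p = 0}"

lemma h_in_rad_P_iff:
  fixes p :: "('v, 'a::field) poly_in"
  assumes "p \<in> polys"
  shows "h p \<in> rad_P \<longleftrightarrow> h p \<in> P_set G R I \<and> jet I {} p = 0"
proof
  assume "h p \<in> rad_P"
  then obtain q :: "('v, 'a) poly_in" where q: "q \<in> polys" "h p = h q" "h q \<in> P_set G R I" "jet I {} q = 0"
    by (auto simp: rad_P_def)
  then have "jet I {} p = jet I {} q"
    using assms I empty_jdx unfolding h_eq_iff_jets[OF assms q(1)] by blast
  with q show "h p \<in> P_set G R I \<and> jet I {} p = 0"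
    by simp
next
  assume "h p \<in> P_set G R I \<and> jet I {} p = 0"
  then show "h p \<in> rad_P"
    using assms unfolding rad_P_def by blast
qed

text \<open>Closure under the algebra rests on the multiplicativity of the jet at
  \<open>(I, {})\<close>.\<close>

lemma submodule_rad_P:
  "submodule rad_P H (P :: (('v, 'a::field) poly_in set, ('v, 'a) poly_in set) module)"
proof -
  interpret M: module H "P :: (('v, 'a) poly_in set, ('v, 'a) poly_in set) module"
    by (rule module_P)
  show ?thesis
  proof (rule M.submoduleI_smult)
    show "rad_P \<subseteq> carrier P"
      by (auto simp: rad_P_def)
    show "\<zero>\<^bsub>P\<^esub> \<in> (rad_P :: ('v, 'a) poly_in set set)"
      using M.zero_closed by (simp add: h_zero h_in_rad_P_iff)
  next
    fix x y :: "('v, 'a) poly_in set"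
    assume "x \<in> rad_P" "y \<in> rad_P"
    then obtain p q :: "('v, 'a) poly_in" where pq: "p \<in> polys" "q \<in> polys" "x = h p" "y = h q" "jet I {} p = 0" "jet I {} q = 0"
      "h p \<in> P_set G R I" "h q \<in> P_set G R I"
      by (auto simp: rad_P_def)
    then have "h (p + q) \<in> P_set G R I"
      using M.a_closed[of "h p" "h q"] by (simp add: h_add)
    then show "x \<oplus>\<^bsub>P\<^esub> y \<in> rad_P"
      using pq by (simp add: h_add h_in_rad_P_iff)
  next
    fix a x :: "('v, 'a) poly_in set"
    assume "a \<in> carrier H" "x \<in> rad_P"
    then obtain p q :: "('v, 'a) poly_in" where pq: "p \<in> polys" "q \<in> polys" "x = h p" "a = h q" "jet I {} p = 0"
      "h p \<in> P_set G R I"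
      by (auto simp: rad_P_def H_carrier)
    then show "a \<odot>\<^bsub>P\<^esub> x \<in> rad_P"
      by (simp add: h_mult h_in_rad_P_iff P_set_mult jet_empty_mult)
  qed
qed

lemma idem_in_P_set: "h (idem I) \<in> P_set G R I"
  using h_mult_idem_in_P_set[of 1] by simp

lemma jet_idem: "jet I {} (idem I) = 1"
  using jet_prod_pvar_mult_idem[OF I empty_jdx empty_jdx] by simp

lemma idem_notin_rad_P: "h (idem I :: ('v, 'a::field) poly_in) \<notin> rad_P"
  using I by (simp add: h_in_rad_P_iff idem_in_polys jet_idem)

text \<open>
  An element \<open>p\<close> with \<open>jet I {} p \<noteq> 0\<close> generates \<open>P\<close>: multiplying it by \<open>X\<^sub>J\<close> gives a nonzero multiple of
  \<open>X\<^sub>J idem I\<close> plus multiples of \<open>X\<^sub>K idem I\<close> with \<open>J \<subset> K\<close>, so that all \<open>X\<^sub>J idem I\<close> are obtained by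
  descending induction on \<open>J\<close>.
\<close>

lemma submodule_subset_rad_P:
  fixes L :: "('v, 'a::field) poly_in set set"
  assumes L: "submodule L H P" and ne: "L \<noteq> carrier P"
  shows "L \<subseteq> rad_P"
proof (rule subsetI, rule ccontr)
  interpret M: module H "P :: (('v, 'a) poly_in set, ('v, 'a) poly_in set) module"
    by (rule module_P)
  fix x
  assume x: "x \<in> L" "x \<notin> rad_P"
  note LE = M.submoduleE[OF L]
  have "x \<in> P_set G R I"
    using x LE(1) by auto
  then obtain p where p: "p \<in> polys" "x = h p" "p * idem I \<sim>\<^sub>H p"
    using P_setE[OF I] by metis
  have a: "jet I {} p \<noteq> 0"
    using x p \<open>x \<in> P_set G R I\<close> by (simp add: h_in_rad_P_iff)
  \<comment> \<open>The preimage of \<open>L\<close> among polynomials, closed under sums and under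
    multiplication by polynomials.\<close>
  define Lp where "Lp = {q \<in> polys. h q \<in> L}"
  have Lp_add: "q + r \<in> Lp" if "q \<in> Lp" "r \<in> Lp" for q r
    using that LE(5)[of "h q" "h r"] by (simp add: Lp_def h_add)
  have Lp_mult: "r * q \<in> Lp" if "q \<in> Lp" "r \<in> polys" for q r
    using that LE(4)[of "h r" "h q"] by (simp add: Lp_def h_mult h_in_carrier)
  have Lp_zero: "0 \<in> Lp"
    using Lp_mult[of p 0] p x by (simp add: Lp_def)
  have Lp_sum: "sum f S \<in> Lp" if "\<And>i. i \<in> S \<Longrightarrow> f i \<in> Lp" for f :: "'v set \<Rightarrow> ('v, 'a) poly_in" and S
    using that by (induction S rule: infinite_finite_induct) (auto simp: Lp_zero intro: Lp_add)
  have T: "T J \<in> Lp" if "J \<in> jdx I" for J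
    using that
  \<comment> \<open>The measure decreases as \<open>J\<close> grows, so larger sets are settled
    first.\<close>
  proof (induction "card R - card J" arbitrary: J rule: less_induct)
    case less
    have J: "J \<subseteq> R" "finite J" "J \<inter> I = {}"
      using less.prems finite_R idx_jdx_disjoint[OF I] by (auto simp: jdx_iff intro: finite_subset)
    define q where "q = (\<Prod>v\<in>J. pvar v) * p"
    have mon: "(\<Prod>v\<in>J. pvar v) \<in> (polys :: ('v, 'a) poly_in set)"
      using J R_subset by (intro prod_pvar_polys) auto
    have q: "q \<in> Lp" "q \<in> polys"
      using p x mon Lp_mult[of p "\<Prod>v\<in>J. pvar v"] by (simp_all add: q_def Lp_def)
    have jet: "jet I K q = (if J \<subseteq> K then jet I (K - J) p else 0)" if "K \<in> jdx I" for K
      unfolding q_def using J idx_jdx_disjoint[OF I that] by (intro jet_prod_pvar_disjoint) auto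
    define r where "r = (\<Sum>K\<in>jdx I - {J}. pconst (jet I K q) * T K)"
    have "pconst (jet I K q) * T K \<in> Lp" if K: "K \<in> jdx I - {J}" for K
    proof (cases "J \<subseteq> K")
      case True
      then have "J \<subset> K" "K \<subseteq> R"
        using K by (auto simp: jdx_iff)
      then have "card J < card K" "card K \<le> card R"
        using psubset_card_mono[OF finite_subset[OF \<open>K \<subseteq> R\<close> finite_R]] card_mono[OF finite_R] by auto
      then have "card R - card K < card R - card J"
        by simp
      then have "T K \<in> Lp"
        using less.hyps K by blast
      then show ?thesis
        by (rule Lp_mult) simp
    next
      case False
      then show ?thesis
        using jet[of K] K Lp_zero by simp
    qed
    then have r: "r \<in> Lp"
      unfolding r_def by (rule Lp_sum)
    have "h q \<in> P_set G R I"
      using q(1) LE(1) by (auto simp: Lp_def)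
    then have "h q = h (\<Sum>K\<in>jdx I. pconst (jet I K q) * T K)"
      using q by (intro P_expand)
    \<comment> \<open>The coefficient at \<open>K = J\<close> is the jet of \<open>p\<close> at
      \<open>J - J = {}\<close>, the scalar known to be nonzero.\<close>
    also have "(\<Sum>K\<in>jdx I. pconst (jet I K q) * T K) = pconst (jet I {} p) * T J + r"
      unfolding r_def using less.prems jet[OF less.prems] finite_jdx by (simp add: sum.remove)
    finally have "pconst (jet I {} p) * T J + r \<in> Lp"
      using q r T_polys[OF less.prems, where 'a = 'a] by (simp add: Lp_def)
    then have "pconst (jet I {} p) * T J \<in> Lp"
      using Lp_add[of "pconst (jet I {} p) * T J + r" "- 1 * r"] Lp_mult[OF r, of "- 1"] by simp
    from Lp_mult[OF this, of "pconst (inverse (jet I {} p))"] show ?case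
      using a by (simp flip: mult.assoc pconst_simps(2) add: pconst_simps(3))
  qed
  \<comment> \<open>The case of empty \<open>J\<close> puts \<open>idem I\<close> into
    \<open>Lp\<close>, and \<open>idem I\<close> generates the summand.\<close>
  have "carrier P \<subseteq> L"
  proof
    fix y
    assume "y \<in> carrier (P :: (('v, 'a) poly_in set, ('v, 'a) poly_in set) module)"
    then obtain q where "q \<in> polys" "y = h (q * idem I)"
      using I by (auto simp: P_set_eq)
    then show "y \<in> L"
      using Lp_mult[OF T[OF empty_jdx], of q] by (simp add: Lp_def)
  qed
  then show False
    using LE(1) ne by auto
qed

section \<open>Indecomposability and the top\<close>

lemma rad_P_neq: "rad_P \<noteq> carrier (P :: (('v, 'a::field) poly_in set, ('v, 'a) poly_in set) module)"
  using idem_notin_rad_P[where 'a = 'a] idem_in_P_set[where 'a = 'a] by (metis P_module_simps(1))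

lemma indecomposable_P:
  "indecomposable H (P :: (('v, 'a::field) poly_in set, ('v, 'a) poly_in set) module)"
  by (rule indecomposable_greatest_submodule[OF module_P submodule_rad_P rad_P_neq submodule_subset_rad_P])

lemma C_module_eq:
  "C_module G R I = quotient_module (P :: (('v, 'a::field) poly_in set, ('v, 'a) poly_in set) module) rad_P"
  unfolding C_module_def top_module_def
  by (subst rad_eq_greatest_submodule[OF module_P submodule_rad_P rad_P_neq submodule_subset_rad_P]) auto

text \<open>Inverses in the record \<open>P\<close> are taken relative to its own carrier, so the
  class of \<open>- q\<close> has to be shown to lie in the summand.\<close>

lemma P_minus:
  fixes p q :: "('v, 'a::field) poly_in"
  assumes "h p \<in> P_set G R I" "h q \<in> P_set G R I" "p \<in> polys" "q \<in> polys"
  shows "h p \<ominus>\<^bsub>P\<^esub> h q = h (p - q)"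
proof -
  interpret M: module H "P :: (('v, 'a) poly_in set, ('v, 'a) poly_in set) module"
    by (rule module_P)
  have mem: "h (- q) \<in> P_set G R I"
    using P_set_mult[OF assms(2,4), of "- 1"] by simp
  have "\<ominus>\<^bsub>P\<^esub> h q = h (- q)"
    using assms mem by (intro M.minus_equality) (simp_all add: h_add h_zero)
  then show ?thesis
    using assms by (simp add: a_minus_def h_add)
qed

abbreviation coset :: "('v, 'a::field) poly_in \<Rightarrow> ('v, 'a) poly_in set set" where
  "coset p \<equiv> rad_P +>\<^bsub>P\<^esub> h p"

text \<open>The difference lies in the kernel of the jet. Computations in the top thereby reduce to
  the scalar \<open>jet I {}\<close>.\<close>

lemma coset_eq:
  fixes p q :: "('v, 'a::field) poly_in"
  assumes "h p \<in> P_set G R I" "h q \<in> P_set G R I" "p \<in> polys" "q \<in> polys"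
    and "jet I {} p = jet I {} q"
  shows "coset p = coset q"
proof -
  have "h (p - q) \<in> P_set G R I"
    using P_minus[OF assms(1-4)] abelian_group.minus_closed[OF module.axioms(2)[OF module_P]] assms(1,2)
    by (metis P_module_simps(1))
  then show ?thesis
    using assms by (subst coset_eq_iff[OF module_P submodule_rad_P]) (simp_all add: P_minus h_in_rad_P_iff)
qed

lemma C_carrierE:
  fixes c :: "('v, 'a::field) poly_in set set"
  assumes "c \<in> carrier (C_module G R I)"
  obtains p where "p \<in> polys" "h p \<in> P_set G R I" "c = coset p"
proof -
  obtain x where "x \<in> P_set G R I" "c = rad_P +>\<^bsub>P\<^esub> x"
    using assms unfolding C_module_eq quotient_module_carrier[OF module_P submodule_rad_P] by auto
  then show ?thesis
    using that P_setE[OF I, of x] by metis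
qed

lemma C_smult:
  fixes p q :: "('v, 'a::field) poly_in"
  assumes "h p \<in> P_set G R I" "p \<in> polys" "q \<in> polys"
  shows "h q \<odot>\<^bsub>C_module G R I\<^esub> coset p = coset (q * p)"
  unfolding C_module_eq using assms
  by (subst quotient_module_smult[OF module_P submodule_rad_P]) (simp_all add: h_in_carrier h_mult)

lemma C_zero: "\<zero>\<^bsub>C_module G R I\<^esub> = coset (0 :: ('v, 'a::field) poly_in)"
proof -
  interpret M: module H "P :: (('v, 'a) poly_in set, ('v, 'a) poly_in set) module"
    by (rule module_P)
  have "rad_P +>\<^bsub>P\<^esub> \<zero>\<^bsub>P\<^esub> = (rad_P :: ('v, 'a) poly_in set set)"
    by (rule M.a_coset_add_zero) (auto simp: rad_P_def)
  then show ?thesis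
    by (simp add: C_module_eq h_zero)
qed

text \<open>Evaluation at the indicator function of \<open>I\<close> sends \<open>x_v\<close> to 1
  or 0, and cosets in the top are determined by this evaluation.\<close>

lemma C_action:
  fixes c :: "('v, 'a::field) poly_in set set"
  assumes "v \<in> verts G" "c \<in> carrier (C_module G R I)"
  shows "H_x G R v \<odot>\<^bsub>C_module G R I\<^esub> c = (if v \<in> I then c else \<zero>\<^bsub>C_module G R I\<^esub>)"
proof -
  obtain p where p: "p \<in> polys" "h p \<in> P_set G R I" "c = coset p"
    using assms(2) by (rule C_carrierE)
  have closed: "h (pvar v * p) \<in> P_set G R I" "h (0 :: ('v, 'a) poly_in) \<in> P_set G R I"
    using p assms(1) P_set_mult[OF p(2,1), of "pvar v"] P_set_mult[OF p(2,1), of 0] by simp_all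
  have "coset (pvar v * p) = coset (if v \<in> I then p else 0)"
    using p assms(1) closed by (intro coset_eq) (simp_all add: jet_pvar_mult)
  then show ?thesis
    using p assms(1) by (simp add: H_x_def C_smult C_zero)
qed

text \<open>The coset of \<open>idem I\<close> is a basis: its jet at \<open>(I, {})\<close> is 1,
  so any coset is its multiple by the jet of a representative.\<close>

lemma dimension_C:
  "has_dimension F (as_vector_space G R (C_module G R I :: (('v, 'a::field) poly_in set, _) module)) 1"
proof -
  let ?C = "C_module G R I :: (('v, 'a) poly_in set, ('v, 'a) poly_in set set) module"
  let ?M = "as_vector_space G R ?C"
  have C: "module H ?C"
    unfolding C_module_eq by (rule module_quotient_module[OF module_P submodule_rad_P])
  have M: "module (F :: 'a ring) ?M"
    unfolding as_vector_space_def by (rule module_restrict_scalars[OF structure_map_hom C])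
  interpret M: module "F :: 'a ring" ?M
    by (rule M)
  have idem: "idem I \<in> (polys :: ('v, 'a) poly_in set)"
    by (rule idem_in_polys[OF I])
  have smult: "c \<odot>\<^bsub>?M\<^esub> coset (idem I) = coset (pconst c * idem I)" for c :: 'a
    using idem by (simp add: C_smult idem_in_P_set)
  have closed: "coset (idem I :: ('v, 'a) poly_in) \<in> carrier ?M"
    unfolding vector_space_simps C_module_eq quotient_module_carrier[OF module_P submodule_rad_P]
    by (simp add: idem_in_P_set)
  have sum: "(\<Oplus>\<^bsub>?M\<^esub>u\<in>{()}. c u \<odot>\<^bsub>?M\<^esub> coset (idem I)) = coset (pconst (c ()) * idem I)" for c
    using M.smult_closed[of "c ()", OF _ closed]
    by (simp del: vector_space_simps flip: smult)
  \<comment> \<open>The one-point index set \<open>{()}\<close> brings the single vector into the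
    form of \<open>is_basis_imageI\<close>; goals 4 and 5 are independence and spanning.\<close>
  have "is_basis (F :: 'a ring) ?M ((\<lambda>u. coset (idem I)) ` {()})"
  proof (rule is_basis_imageI[OF M], goal_cases)
    case (4 c)
    have "coset (pconst (c ()) * idem I) = coset 0"
      using 4(2)[unfolded sum] by (simp only: vector_space_simps C_zero)
    then have "h (pconst (c ()) * idem I) \<ominus>\<^bsub>P\<^esub> h 0 \<in> rad_P"
      using h_mult_idem_in_P_set[of "0 :: ('v, 'a) poly_in"] h_mult_idem_in_P_set[of "pconst (c ())"]
      by (subst (asm) coset_eq_iff[OF module_P submodule_rad_P]) simp_all
    then have "h (pconst (c ()) * idem I) \<in> rad_P"
      using h_mult_idem_in_P_set[of "0 :: ('v, 'a) poly_in"] h_mult_idem_in_P_set[of "pconst (c ())"] idem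
      by (subst (asm) P_minus) simp_all
    then show ?case
      using idem by (simp add: h_in_rad_P_iff jet_idem)
  next
    case (5 m)
    then have "m \<in> carrier ?C"
      by simp
    then obtain p where p: "p \<in> polys" "h p \<in> P_set G R I" "m = coset p"
      by (rule C_carrierE)
    have "m = coset (pconst (jet I {} p) * idem I)"
      unfolding p(3) using p idem
      by (intro coset_eq h_mult_idem_in_P_set) (simp_all add: jet_idem)
    then show ?case
      unfolding sum by (intro bexI[of _ "\<lambda>_. jet I {} p"]) auto
  qed (use closed in auto)
  then show ?thesis
    unfolding has_dimension_def by (intro exI[of _ "{coset (idem I)}"]) simp
qed

end

end

theorem theorem6p5:
  fixes G :: "('v, 'e) pre_digraph" and R :: "'v set"
  assumes "graph G" and "R \<subseteq> verts G"
  shows "let H = (H_alg G R :: ('v, 'a::field) poly_in set ring);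
             F = (ring_of_type_algebra :: 'a ring)
         in is_direct_sum H (H_module G R) (independent_sets (G \<restriction> (verts G - R))) (P_set G R) \<and>
            (\<forall>I\<in>independent_sets (G \<restriction> (verts G - R)).
               let P = (P_module G R I :: (('v, 'a) poly_in set, ('v, 'a) poly_in set) module);
                   C = (C_module G R I :: (('v, 'a) poly_in set, ('v, 'a) poly_in set set) module)
               in indecomposable H P \<and>
                  is_basis F (as_vector_space G R P)
                    {H_X G R (I \<union> J) \<otimes>\<^bsub>H\<^esub> H_X_minus G R (verts G - R - I) | J.
                       J \<in> independent_sets (G \<restriction> (R - neighbours G I))} \<and>
                  has_dimension F (as_vector_space G R P)
                    (card (independent_sets (G \<restriction> (R - neighbours G I)))) \<and>
                  has_dimension F (as_vector_space G R C) 1 \<and>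
                  (\<forall>v\<in>verts G. \<forall>c\<in>carrier C.
                     H_x G R v \<odot>\<^bsub>C\<^esub> c = (if v \<in> I then c else \<zero>\<^bsub>C\<^esub>)))"
proof -
  interpret G: graph_with_squares G R
    using assms by (simp add: graph_with_squares_def graph_with_squares_axioms_def)
  have basis: "{H_X G R (I \<union> J) \<otimes>\<^bsub>H_alg G R\<^esub> H_X_minus G R (verts G - R - I) | J. J \<in> G.jdx I} =
      (\<lambda>J. H_class G R (G.T I J :: ('v, 'a) poly_in)) ` G.jdx I" if "I \<in> G.idx" for I
    using G.H_X_H_X_minus[OF that, where 'a = 'a] by blast
  \<comment> \<open>Injectivity of the indexing makes the basis as large as
    \<open>jdx I\<close>.\<close>
  have dim: "has_dimension (ring_of_type_algebra :: 'a ring)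
      (as_vector_space G R (P_module G R I :: (('v, 'a) poly_in set, ('v, 'a) poly_in set) module))
      (card (G.jdx I))" if "I \<in> G.idx" for I
    unfolding has_dimension_def
    using G.is_basis_P[OF that, where 'a = 'a] G.finite_jdx card_image[OF G.inj_on_T[OF that, where 'a = 'a]]
    by blast
  show ?thesis
    unfolding Let_def
    using G.direct_sum_P_set[where 'a = 'a] G.indecomposable_P[where 'a = 'a] G.is_basis_P[where 'a = 'a] dim
      G.dimension_C[where 'a = 'a] G.C_action[where 'a = 'a]
    by (intro conjI ballI) (simp_all only: basis)
qed

end
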